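(* Let $d \geq 1$ be an integer, let $S$ be a (possibly non-abelian) finite discrete group and let $X \subset S^{\mathbb{Z}^d}$ be a closed subgroup that is invariant under the $\mathbb{Z}^d$-shift. Then the algebraic dynamical system $(X,\mathbb{Z}^d)$, where the action of $\mathbb{Z}^d$ on $X$ is the one induced by restriction of the $\mathbb{Z}^d$-shift, is surjunctive, i.e., every injective continuous $\mathbb{Z}^d$-equivariant map $\tau \colon X \to X$ is surjective.
   Context: $S^{\mathbb{Z}^d} = \{x \colon \mathbb{Z}^d \to S\}$ is equipped with the product topology and the pointwise group structure. The $\mathbb{Z}^d$-shift is the action of $\mathbb{Z}^d$ on $S^{\mathbb{Z}^d}$ given by $(\gamma x)(\gamma') := x(\gamma' - \gamma)$ for all $\gamma,\gamma' \in \mathbb{Z}^d$ and $x \in S^{\mathbb{Z}^d}$. An algebraic dynamical system is a pair $(X,\Gamma)$ where $X$ is a compact metrizable topological group and $\Gamma$ is a countable group acting on $X$ by continuous group automorphisms. A map $\tau \colon X \to X$ is $\Gamma$-equivariant if $\tau(\gamma x) = \gamma\tau(x)$ for all $\gamma \in \Gamma$ and $x \in X$ (the map $\tau$ is not assumed to be a group homomorphism). The system $(X,\Gamma)$ is surjunctive if every injective $\Gamma$-equivariant continuous map $\tau \colon X \to X$ is surjective. *)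

theory Defs
  imports
    "HOL-Analysis.Analysis"
    "HOL-Algebra.Product_Groups"
    "HOL-Algebra.Group_Action"
begin

locale topological_group = group G for G (structure) +
  fixes T :: "'a topology"
  assumes topspace_eq_carrier: "topspace T = carrier G"
    and continuous_mult: "continuous_map (prod_topology T T) T (\<lambda>(x, y). x \<otimes> y)"
    and continuous_inv: "continuous_map T T (\<lambda>x. inv x)"

(* auto G consists of the group automorphisms of G, taken extensional on carrier G. *)
locale algebraic_dynamical_system =
  topological_group G T + group_action \<Gamma> "carrier G" \<phi>
  for G :: "('a, 'b) monoid_scheme" (structure) and T :: "'a topology"
    and \<Gamma> :: "('g, 'c) monoid_scheme" and \<phi> :: "'g \<Rightarrow> 'a \<Rightarrow> 'a" +
  assumes compact: "compact_space T"
    and metrizable: "metrizable_space T"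
    and countable_acting_group: "countable (carrier \<Gamma>)"
    and action_automorphism: "\<gamma> \<in> carrier \<Gamma> \<Longrightarrow> \<phi> \<gamma> \<in> auto G"
    and action_continuous: "\<gamma> \<in> carrier \<Gamma> \<Longrightarrow> continuous_map T T (\<phi> \<gamma>)"

definition equivariant_map ::
  "('g, 'c) monoid_scheme \<Rightarrow> ('g \<Rightarrow> 'a \<Rightarrow> 'a) \<Rightarrow> 'a set \<Rightarrow> ('a \<Rightarrow> 'a) \<Rightarrow> bool"
  where "equivariant_map \<Gamma> \<phi> X \<tau> \<longleftrightarrow>
    (\<forall>\<gamma>\<in>carrier \<Gamma>. \<forall>x\<in>X. \<tau> (\<phi> \<gamma> x) = \<phi> \<gamma> (\<tau> x))"

definition surjunctive ::
  "'a topology \<Rightarrow> ('g, 'c) monoid_scheme \<Rightarrow> ('g \<Rightarrow> 'a \<Rightarrow> 'a) \<Rightarrow> bool"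
  where "surjunctive T \<Gamma> \<phi> \<longleftrightarrow>
    (\<forall>\<tau>. continuous_map T T \<tau> \<and> inj_on \<tau> (topspace T) \<and> equivariant_map \<Gamma> \<phi> (topspace T) \<tau>
      \<longrightarrow> \<tau> ` topspace T = topspace T)"

(* The additive group Z^d; its elements are functions on {..<d}, extensional outside it. *)
definition lattice_group :: "nat \<Rightarrow> (nat \<Rightarrow> int) monoid"
  where "lattice_group d = product_group {..<d} (\<lambda>_. integer_group)"

definition full_shift_group :: "nat \<Rightarrow> ('s, 'b) monoid_scheme \<Rightarrow> ((nat \<Rightarrow> int) \<Rightarrow> 's) monoid"
  where "full_shift_group d S = product_group (carrier (lattice_group d)) (\<lambda>_. S)"

definition full_shift_topology :: "nat \<Rightarrow> ('s, 'b) monoid_scheme \<Rightarrow> ((nat \<Rightarrow> int) \<Rightarrow> 's) topology"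
  where "full_shift_topology d S =
    product_topology (\<lambda>_. discrete_topology (carrier S)) (carrier (lattice_group d))"

definition shift :: "nat \<Rightarrow> (nat \<Rightarrow> int) \<Rightarrow> ((nat \<Rightarrow> int) \<Rightarrow> 's) \<Rightarrow> (nat \<Rightarrow> int) \<Rightarrow> 's"
  where "shift d \<gamma> x = (\<lambda>\<gamma>'\<in>carrier (lattice_group d). x (\<lambda>i\<in>{..<d}. \<gamma>' i - \<gamma> i))"

end

theory Submission
  imports Defs "HOL-Library.Function_Algebras"
begin

text \<open>
  The reason behind the theorem is that the periodic points of a group shift are dense. For every
  \<open>k > 0\<close> the set of points of \<open>X\<close> fixed by \<open>k\<int>\<^sup>d\<close> is finite, and an equivariant injection \<open>\<tau>\<close>
  maps it into itself, hence onto itself. So the image of \<open>\<tau>\<close> contains all periodic points; being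
  compact, it contains their closure, which is \<open>X\<close>.

  Density (\<open>periodic_approximation_every_rank\<close>) is proved by two nested inductions. Instead of
  points one considers cosets \<open>x + N\<close> of a compact shift-invariant subgroup \<open>N\<close> (groups of values
  are written additively though they need not commute), invariant under \<open>k\<Lambda>\<close> for the lattice \<open>\<Lambda>\<close>
  that acts. The aim is to shrink \<open>N\<close> to \<open>{0}\<close> while moving \<open>x\<close> inside the coset without
  changing it on a given finite window, and enlarging \<open>k\<close>; at the end \<open>x\<close> itself is periodic. Each step
  (\<open>periodic_descent\<close>) picks an orbit of \<open>\<Lambda>\<close> on which \<open>N\<close> takes a nontrivial group \<open>G\<close> of values, a
  maximal proper normal subgroup \<open>K\<close> of \<open>G\<close>, and replaces \<open>N\<close> by those of its members whose values
  on that orbit lie in \<open>K\<close>. The values on the orbit are thereby read in the simple group \<open>G / K\<close>,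
  and simplicity leaves just two possibilities.

  \<^item> Every finite pattern over \<open>G / K\<close> is realised by \<open>N\<close>. Then \<open>N\<close> maps onto the full shift over
    \<open>G / K\<close>, where a periodic pattern can be prescribed at will (\<open>periodic_descent_free\<close>).

  \<^item> Some finite set of sites carries an unrealised pattern. In a minimal such set the value at each
    site is determined modulo \<open>K\<close> by the values at the others
    (\<open>minimal_unrealised_determines\<close>). Choosing a linear height that separates the sites, one
    sees that a strip of bounded height determines everything modulo \<open>K\<close>
    (\<open>strip_determines\<close>). On the strip only the kernel of the height acts, a lattice of smaller
    rank, so the outer induction supplies periodicity in these directions. The points having the
    periods so obtained form finitely many classes, which the remaining direction permutes;
    therefore it too acts periodically (\<open>periodic_descent_strip\<close>).

  The periods grow in the course of the descent, but the number of steps is bounded in advance,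
  since it is measured on the orbits of the fixed lattice \<open>\<Lambda>\<close>.
\<close>

section \<open>Lattices\<close>

text \<open>The ambient group is the additive group of a commutative ring only so that integer
  multiples can be written \<open>of_int k * v\<close>. Bases are built up one vector at a time, since the
  induction on the rank removes one direction at a time.\<close>
inductive free_lattice :: "nat \<Rightarrow> 'g::comm_ring_1 set \<Rightarrow> bool" where
  lattice_0: "free_lattice 0 {0}"
| lattice_Suc: "free_lattice (Suc d) {m + of_int k * v | m k. m \<in> M}"
    if "free_lattice d M" and "\<And>k::int. of_int k * v \<in> M \<Longrightarrow> k = 0"

lemma lattice_closed:
  assumes "free_lattice d \<Lambda>"
  shows "0 \<in> \<Lambda>" and "\<And>a b. a \<in> \<Lambda> \<Longrightarrow> b \<in> \<Lambda> \<Longrightarrow> a + b \<in> \<Lambda>" and "\<And>a k. a \<in> \<Lambda> \<Longrightarrow> of_int k * a \<in> \<Lambda>"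
proof -
  have "0 \<in> \<Lambda> \<and> (\<forall>a\<in>\<Lambda>. \<forall>b\<in>\<Lambda>. a + b \<in> \<Lambda>) \<and> (\<forall>a\<in>\<Lambda>. \<forall>k. of_int k * a \<in> \<Lambda>)"
    using assms
  proof induction
    case (lattice_Suc d M v)
    let ?L = "{m + of_int k * v | m k. m \<in> M}"
    have "0 \<in> ?L"
      using lattice_Suc by (auto intro!: exI[of _ 0])
    moreover have "a + b \<in> ?L" if ab: "a \<in> ?L" "b \<in> ?L" for a b
    proof -
      obtain m k m' k' where "a = m + of_int k * v" "b = m' + of_int k' * v" "m \<in> M" "m' \<in> M"
        using ab by auto
      then have "a + b = (m + m') + of_int (k + k') * v" "m + m' \<in> M"
        using lattice_Suc by (auto simp: algebra_simps)
      then show ?thesis by blast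
    qed
    moreover have "of_int j * a \<in> ?L" if a: "a \<in> ?L" for a j
    proof -
      obtain m k where "a = m + of_int k * v" "m \<in> M"
        using a by auto
      then have "of_int j * a = of_int j * m + of_int (j * k) * v" "of_int j * m \<in> M"
        using lattice_Suc by (auto simp: algebra_simps)
      then show ?thesis by blast
    qed
    ultimately show ?case by blast
  qed auto
  then show "0 \<in> \<Lambda>" "\<And>a b. a \<in> \<Lambda> \<Longrightarrow> b \<in> \<Lambda> \<Longrightarrow> a + b \<in> \<Lambda>" "\<And>a k. a \<in> \<Lambda> \<Longrightarrow> of_int k * a \<in> \<Lambda>"
    by blast+
qed

lemma lattice_minus:
  assumes "free_lattice d \<Lambda>" and "a \<in> \<Lambda>"
  shows "- a \<in> \<Lambda>" and "b \<in> \<Lambda> \<Longrightarrow> b - a \<in> \<Lambda>"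
proof -
  show *: "- a \<in> \<Lambda>"
    using lattice_closed(3)[OF assms, of "-1"] by simp
  show "b - a \<in> \<Lambda>" if "b \<in> \<Lambda>"
    using lattice_closed(2)[OF assms(1) that *] by simp
qed

lemma lattice_finite_index:
  assumes "free_lattice d \<Lambda>" and "k > 0"
  obtains R where "finite R" and "R \<subseteq> \<Lambda>" and "\<forall>a\<in>\<Lambda>. \<exists>r\<in>R. \<exists>b\<in>\<Lambda>. a = r + of_int k * b"
proof -
  have "\<exists>R. finite R \<and> R \<subseteq> \<Lambda> \<and> (\<forall>a\<in>\<Lambda>. \<exists>r\<in>R. \<exists>b\<in>\<Lambda>. a = r + of_int k * b)"
    using assms(1)
  proof induction
    case lattice_0
    show ?case by (rule exI[of _ "{0}"]) auto
  next
    case (lattice_Suc d M v)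
    obtain R where R: "finite R" "R \<subseteq> M" "\<forall>a\<in>M. \<exists>r\<in>R. \<exists>b\<in>M. a = r + of_int k * b"
      using lattice_Suc.IH by blast
    define R' where "R' = (\<lambda>(r, j). r + of_int j * v) ` (R \<times> {0..<k})"
    have "\<exists>r\<in>R'. \<exists>b\<in>{m + of_int j * v | m j. m \<in> M}. m + of_int j * v = r + of_int k * b"
      if m: "m \<in> M" for m j
    proof -
      obtain r b where rb: "r \<in> R" "b \<in> M" "m = r + of_int k * b"
        using R(3) m by blast
      have "of_int j = (of_int (j mod k) + of_int k * of_int (j div k) :: 'a)"
        by (metis mod_mult_div_eq of_int_add of_int_mult)
      then have "m + of_int j * v = (r + of_int (j mod k) * v) + of_int k * (b + of_int (j div k) * v)"
        by (simp add: rb(3) algebra_simps)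
      moreover have "r + of_int (j mod k) * v \<in> R'"
        using rb(1) \<open>k > 0\<close> by (auto simp: R'_def intro!: image_eqI[of _ _ "(r, j mod k)"])
      ultimately show ?thesis
        using rb(2) by blast
    qed
    moreover have "finite R'" "R' \<subseteq> {m + of_int j * v | m j. m \<in> M}"
      using R(1,2) by (auto simp: R'_def)
    ultimately show ?case by blast
  qed
  then show ?thesis using that by blast
qed

definition additive_on :: "'g::plus set \<Rightarrow> ('g \<Rightarrow> 'h::plus) \<Rightarrow> bool" where
  "additive_on \<Lambda> c \<longleftrightarrow> (\<forall>a\<in>\<Lambda>. \<forall>b\<in>\<Lambda>. c (a + b) = c a + c b)"

text \<open>The last basis vector \<open>v\<close> is independent of the others, so its coefficient \<open>c\<close> is a
  well-defined additive function.\<close>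
lemma lattice_coordinate:
  assumes "free_lattice (Suc d) \<Lambda>"
  obtains M v and c :: "'g::comm_ring_1 \<Rightarrow> int"
  where "free_lattice d M" and "M \<subseteq> \<Lambda>" and "v \<in> \<Lambda>" and "c v = 1"
    and "additive_on \<Lambda> c" and "\<forall>a\<in>M. c a = 0"
    and "\<forall>a\<in>\<Lambda>. a - of_int (c a) * v \<in> M"
proof -
  obtain M v where M: "free_lattice d M" and L: "\<Lambda> = {m + of_int k * v | m k. m \<in> M}"
    and free: "\<And>k::int. of_int k * v \<in> M \<Longrightarrow> k = 0"
    using assms by (cases rule: free_lattice.cases) auto
  have unique: "k = k'" if "m \<in> M" "m' \<in> M" "m + of_int k * v = m' + of_int k' * v" for m m' k k'
  proof -
    have "of_int (k - k') * v = m' - m"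
      using that(3) by (simp add: algebra_simps)
    then have "of_int (k - k') * v \<in> M"
      using lattice_minus(2)[OF M that(1,2)] by simp
    from free[OF this] show ?thesis by simp
  qed
  define c where "c a = (THE k. \<exists>m\<in>M. a = m + of_int k * v)" for a
  have c: "c (m + of_int k * v) = k" if "m \<in> M" for m k
    unfolding c_def using that unique by (intro the_equality) blast+
  note closed = lattice_closed[OF M]
  have "c m = 0" if "m \<in> M" for m
    using c[OF that, of 0] by simp
  moreover have "c v = 1"
    using c[OF closed(1), of 1] by simp
  moreover have "additive_on \<Lambda> c"
    unfolding additive_on_def
  proof (intro ballI)
    fix a b assume ab: "a \<in> \<Lambda>" "b \<in> \<Lambda>"
    obtain m k m' k' where a: "a = m + of_int k * v" "m \<in> M" and b: "b = m' + of_int k' * v" "m' \<in> M"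
      using ab unfolding L by auto
    have "a + b = (m + m') + of_int (k + k') * v"
      using a b by (simp add: algebra_simps)
    then show "c (a + b) = c a + c b"
      using c[OF closed(2)[OF a(2) b(2)], of "k + k'"] c a b by metis
  qed
  moreover have "a - of_int (c a) * v \<in> M" if "a \<in> \<Lambda>" for a
    using that c unfolding L by auto
  moreover have "v \<in> \<Lambda>"
  proof -
    have "v = 0 + of_int 1 * v" by simp
    then show ?thesis unfolding L using closed(1) by blast
  qed
  moreover have "M \<subseteq> \<Lambda>"
  proof
    fix m assume "m \<in> M"
    moreover have "m = m + of_int 0 * v" by simp
    ultimately show "m \<in> \<Lambda>" unfolding L by blast
  qed
  ultimately show ?thesis
    using M that by metis
qed

lemma lattice_SucI:
  assumes "free_lattice d M" and "\<And>k::int. of_int k * v \<in> M \<Longrightarrow> k = 0"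
    and "\<And>a. a \<in> \<Lambda> \<longleftrightarrow> (\<exists>k::int. a - of_int k * v \<in> M)"
  shows "free_lattice (Suc d) \<Lambda>"
proof -
  have "\<Lambda> = {m + of_int k * v | m k. m \<in> M}"
  proof (intro equalityI subsetI)
    fix a assume "a \<in> \<Lambda>"
    then obtain k :: int where "a - of_int k * v \<in> M" using assms(3) by blast
    moreover have "a = (a - of_int k * v) + of_int k * v" by simp
    ultimately show "a \<in> {m + of_int k * v | m k. m \<in> M}" by blast
  next
    fix a assume "a \<in> {m + of_int k * v | m k. m \<in> M}"
    then obtain m k where "a = m + of_int k * v" "m \<in> M" by blast
    then show "a \<in> \<Lambda>" using assms(3) by (auto intro!: exI[of _ k])
  qed
  then show ?thesis
    using free_lattice.lattice_Suc[OF assms(1,2)] by simp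
qed

lemma additive_on_lattice:
  fixes h :: "'g::comm_ring_1 \<Rightarrow> int"
  assumes "free_lattice d \<Lambda>" and "additive_on \<Lambda> h"
  shows "a \<in> \<Lambda> \<Longrightarrow> b \<in> \<Lambda> \<Longrightarrow> h (a + b) = h a + h b"
    and "h 0 = 0" and "a \<in> \<Lambda> \<Longrightarrow> h (- a) = - h a" and "a \<in> \<Lambda> \<Longrightarrow> b \<in> \<Lambda> \<Longrightarrow> h (b - a) = h b - h a"
    and "a \<in> \<Lambda> \<Longrightarrow> h (of_int k * a) = k * h a"
proof -
  note closed = lattice_closed[OF assms(1)] lattice_minus[OF assms(1)]
  have h: "h (a + b) = h a + h b" if "a \<in> \<Lambda>" "b \<in> \<Lambda>" for a b
    using assms(2) that by (simp add: additive_on_def)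
  then show "a \<in> \<Lambda> \<Longrightarrow> b \<in> \<Lambda> \<Longrightarrow> h (a + b) = h a + h b" .
  show 0: "h 0 = 0" using h[OF closed(1,1)] by simp
  have minus: "h (- a) = - h a" if "a \<in> \<Lambda>" for a
    using h[OF that closed(4)[OF that]] 0 by simp
  then show "a \<in> \<Lambda> \<Longrightarrow> h (- a) = - h a" .
  have diff: "h (b - a) = h b - h a" if "a \<in> \<Lambda>" "b \<in> \<Lambda>" for a b
    using h[OF that(2) closed(4)[OF that(1)]] minus[OF that(1)] by simp
  then show "a \<in> \<Lambda> \<Longrightarrow> b \<in> \<Lambda> \<Longrightarrow> h (b - a) = h b - h a" .
  show "h (of_int k * a) = k * h a" if a: "a \<in> \<Lambda>"
  proof (induction k rule: int_induct[where k = 0])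
    case base
    show ?case using 0 by simp
  next
    case (step1 i)
    have "of_int (i + 1) * a = of_int i * a + a" by (simp add: algebra_simps)
    then show ?case using h[OF closed(3)[OF a, of i] a] step1 by (simp add: algebra_simps)
  next
    case (step2 i)
    have "of_int (i - 1) * a = of_int i * a - a" by (simp add: algebra_simps)
    then show ?case using diff[OF a closed(3)[OF a, of i]] step2 by (simp add: algebra_simps)
  qed
qed

lemma bounded_differences:
  fixes f :: "'a \<Rightarrow> int"
  assumes "finite V"
  obtains B where "B > 0" and "\<forall>v\<in>V. \<forall>w\<in>V. \<bar>f v - f w\<bar> < B"
proof -
  have "finite ((\<lambda>(v, w). \<bar>f v - f w\<bar>) ` (V \<times> V))"
    using assms by simp
  then obtain B where "\<forall>b\<in>(\<lambda>(v, w). \<bar>f v - f w\<bar>) ` (V \<times> V). b < B"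
    by (metis bdd_above_finite bdd_above.unfold gt_ex order_le_less_trans)
  then show ?thesis
    by (intro that[of "max B 1"]) fastforce+
qed

text \<open>A linear form that is injective on a given finite set and takes the value 1, so that its
  kernel is a complement of \<open>\<int> v\<close>. With a form \<open>h\<close> for the projection to the sublattice and the
  coordinate \<open>c\<close> along the last basis vector, the form \<open>B * h + c\<close> separates the points as soon as
  \<open>B\<close> exceeds all differences of the coordinates \<open>c\<close>. Its kernel arises from the kernel of \<open>h\<close>
  by adjoining \<open>v0 - B * v\<close>, where \<open>v0\<close> is a vector of the sublattice with \<open>h v0 = 1\<close>.\<close>
lemma lattice_height:
  assumes "free_lattice (Suc d) \<Lambda>" and "finite W" and "W \<subseteq> \<Lambda>"
  obtains h :: "'g::comm_ring_1 \<Rightarrow> int" and v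
  where "v \<in> \<Lambda>" and "h v = 1" and "additive_on \<Lambda> h" and "inj_on h W" and "free_lattice d {a \<in> \<Lambda>. h a = 0}"
proof -
  have "\<exists>h v. v \<in> \<Lambda> \<and> h v = (1::int) \<and> additive_on \<Lambda> h
      \<and> inj_on h W \<and> free_lattice d {a \<in> \<Lambda>. h a = 0}"
    using assms
  proof (induction d arbitrary: \<Lambda> W)
    case (0 \<Lambda> W)
    obtain M v c where M: "free_lattice 0 M" "M \<subseteq> \<Lambda>" "v \<in> \<Lambda>" "c v = (1::int)"
      and c: "additive_on \<Lambda> c" and "\<forall>a\<in>M. c a = 0"
      and decomp: "\<forall>a\<in>\<Lambda>. a - of_int (c a) * v \<in> M"
      by (rule lattice_coordinate[OF 0(1)])
    have "M = {0}" using M by (auto elim: free_lattice.cases)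
    then have eq: "a = of_int (c a) * v" if "a \<in> \<Lambda>" for a
      using decomp that by simp
    have "{a \<in> \<Lambda>. c a = 0} = {0}"
      using eq lattice_closed(1)[OF 0(1)] additive_on_lattice(2)[OF 0(1) c] by fastforce
    moreover have "inj_on c W"
      using eq 0(3) by (metis inj_onI subsetD)
    ultimately show ?case
      using M c lattice_0 by (intro exI[of _ c] exI[of _ v]) auto
  next
    case (Suc d \<Lambda> W)
    obtain M v c where M: "free_lattice (Suc d) M" "M \<subseteq> \<Lambda>" and v: "v \<in> \<Lambda>" "c v = (1::int)"
      and c: "additive_on \<Lambda> c" and c0: "\<forall>a\<in>M. c a = 0"
      and decomp: "\<forall>a\<in>\<Lambda>. a - of_int (c a) * v \<in> M"
      by (rule lattice_coordinate[OF Suc.prems(1)])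
    define p where "p a = a - of_int (c a) * v" for a
    have p: "p a \<in> M" if "a \<in> \<Lambda>" for a using decomp that by (simp add: p_def)
    have p_add: "p (a + b) = p a + p b" if "a \<in> \<Lambda>" "b \<in> \<Lambda>" for a b
      using c that by (simp add: additive_on_def p_def algebra_simps)
    have "finite (p ` W)" "p ` W \<subseteq> M"
      using Suc.prems p by auto
    from Suc.IH[OF M(1) this] obtain h v0 where
      "v0 \<in> M \<and> h v0 = (1::int) \<and> additive_on M h
        \<and> inj_on h (p ` W) \<and> free_lattice d {a \<in> M. h a = 0}"
      by (elim exE)
    then have v0: "v0 \<in> M" "h v0 = (1::int)"
      and h: "additive_on M h" and inj: "inj_on h (p ` W)" and ker: "free_lattice d {a \<in> M. h a = 0}"
      by auto
    note addc = additive_on_lattice[where h = c, OF Suc.prems(1) c]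
      and addh = additive_on_lattice[where h = h, OF M(1) h]
      and clM = lattice_closed[OF M(1)] lattice_minus[OF M(1)]
      and clL = lattice_closed[OF Suc.prems(1)] lattice_minus[OF Suc.prems(1)]
    obtain B where "B > 0" and B: "\<forall>w\<in>W. \<forall>w'\<in>W. \<bar>c w - c w'\<bar> < B"
      using bounded_differences[OF Suc.prems(2)] .
    define l where "l a = B * h (p a) + c a" for a
    have "p v = 0" by (simp add: p_def v)
    have "l v = 1" by (simp add: l_def \<open>p v = 0\<close> addh(2) v)
    moreover have "additive_on \<Lambda> l"
      by (simp add: additive_on_def l_def p_add addc(1) addh(1) p algebra_simps)
    moreover have "inj_on l W"
    proof (rule inj_onI)
      fix w w' assume w: "w \<in> W" "w' \<in> W" and "l w = l w'"
      then have eq: "B * (h (p w) - h (p w')) = c w' - c w"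
        by (simp add: l_def algebra_simps)
      have "\<bar>h (p w) - h (p w')\<bar> < 1"
      proof (rule ccontr)
        assume "\<not> ?thesis"
        then have "B * 1 \<le> B * \<bar>h (p w) - h (p w')\<bar>"
          using \<open>B > 0\<close> by (intro mult_left_mono) auto
        moreover have "B * \<bar>h (p w) - h (p w')\<bar> = \<bar>c w' - c w\<bar>"
          using arg_cong[OF eq, of abs] \<open>B > 0\<close> by (simp add: abs_mult)
        ultimately show False
          using B w(1,2) by fastforce
      qed
      then have "h (p w) = h (p w')" by simp
      then have "p w = p w'" "c w = c w'"
        using eq inj w by (auto dest: inj_onD)
      then show "w = w'" by (simp add: p_def)
    qed
    moreover have "free_lattice (Suc d) {a \<in> \<Lambda>. l a = 0}"
    proof (rule lattice_SucI[OF ker, of "v0 - of_int B * v"])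
      have c_u: "c (v0 - of_int B * v) = - B"
        using v v0 M(2) c0 clL(3) addc by (simp add: subset_iff)
      have u: "v0 - of_int B * v \<in> \<Lambda>" using v v0 M(2) clL by blast
      have p_u: "p (v0 - of_int B * v) = v0"
        unfolding p_def c_u by (simp add: algebra_simps)
      show "k = 0" if "of_int k * (v0 - of_int B * v) \<in> {a \<in> M. h a = 0}" for k :: int
      proof -
        have "c (of_int k * (v0 - of_int B * v)) = 0"
          using that c0 by blast
        then show ?thesis
          using addc(5)[OF u] c_u \<open>B > 0\<close> by simp
      qed
      show "a \<in> {a \<in> \<Lambda>. l a = 0} \<longleftrightarrow> (\<exists>k::int. a - of_int k * (v0 - of_int B * v) \<in> {a \<in> M. h a = 0})" for a
      proof
        assume a: "a \<in> {a \<in> \<Lambda>. l a = 0}"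
        then have pa: "p a \<in> M" and ca: "c a = - (B * h (p a))"
          using p by (auto simp: l_def)
        have "p a = a + of_int (B * h (p a)) * v"
          using ca by (metis add.commute diff_add_cancel diff_conv_add_uminus mult_minus_left of_int_minus p_def minus_minus)
        then have "a - of_int (h (p a)) * (v0 - of_int B * v) = p a - of_int (h (p a)) * v0"
          by (simp add: algebra_simps)
        moreover have "p a - of_int (h (p a)) * v0 \<in> {a \<in> M. h a = 0}"
          using pa v0 clM addh by simp
        ultimately show "\<exists>k::int. a - of_int k * (v0 - of_int B * v) \<in> {a \<in> M. h a = 0}"
          by (intro exI[of _ "h (p a)"]) simp
      next
        assume "\<exists>k::int. a - of_int k * (v0 - of_int B * v) \<in> {a \<in> M. h a = 0}"
        then obtain k :: int where k: "a - of_int k * (v0 - of_int B * v) \<in> {a \<in> M. h a = 0}" ..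
        define m where "m = a - of_int k * (v0 - of_int B * v)"
        have m: "m \<in> M" "h m = 0" and a: "a = m + of_int k * (v0 - of_int B * v)"
          using k by (simp_all add: m_def)
        have ku: "of_int k * (v0 - of_int B * v) \<in> \<Lambda>" using u clL(3) by blast
        then have aL: "a \<in> \<Lambda>" unfolding a using m M(2) clL(2) by blast
        have ca: "c a = - (k * B)"
          unfolding a using addc(1)[OF _ ku, of m] m M(2) c0 addc(5)[OF u] c_u by auto
        have "p a = m + of_int k * v0"
          unfolding p_def ca by (simp add: a algebra_simps)
        then have "h (p a) = k"
          using addh(1)[OF m(1) clM(3)[OF v0(1), of k]] addh(5)[OF v0(1)] m v0 by simp
        then show "a \<in> {a \<in> \<Lambda>. l a = 0}"
          using aL ca by (simp add: l_def)
      qed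
    qed
    ultimately show ?case
      using v(1) by (intro exI[of _ l] exI[of _ v]) auto
  qed
  then show ?thesis using that by blast
qed

section \<open>Subgroups of configurations\<close>

definition add_subgroup :: "'a::group_add set \<Rightarrow> bool" where
  "add_subgroup G \<longleftrightarrow> 0 \<in> G \<and> (\<forall>a\<in>G. \<forall>b\<in>G. a + b \<in> G) \<and> (\<forall>a\<in>G. - a \<in> G)"

definition normal_subgroup :: "'a::group_add set \<Rightarrow> 'a set \<Rightarrow> bool" where
  "normal_subgroup K G \<longleftrightarrow> add_subgroup K \<and> K \<subseteq> G \<and> (\<forall>g\<in>G. \<forall>k\<in>K. g + k - g \<in> K)"

lemma add_subgroupD:
  assumes "add_subgroup G"
  shows "0 \<in> G" and "a \<in> G \<Longrightarrow> b \<in> G \<Longrightarrow> a + b \<in> G" and "a \<in> G \<Longrightarrow> - a \<in> G"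
    and "a \<in> G \<Longrightarrow> b \<in> G \<Longrightarrow> a - b \<in> G"
proof -
  show "0 \<in> G" "a \<in> G \<Longrightarrow> b \<in> G \<Longrightarrow> a + b \<in> G" "a \<in> G \<Longrightarrow> - a \<in> G"
    using assms by (auto simp: add_subgroup_def)
  show "a - b \<in> G" if "a \<in> G" "b \<in> G"
    using assms that add_uminus_conv_diff[of a b] by (metis add_subgroup_def)
qed

text \<open>Congruence modulo left cosets, \<open>a + K = b + K\<close>, is written \<open>- a + b \<in> K\<close>.\<close>
lemma left_cong_trans:
  assumes "add_subgroup K" "- a + b \<in> K" "- b + c \<in> K"
  shows "- a + c \<in> K"
  using add_subgroupD(2)[OF assms] by (simp add: add.assoc)

lemma left_cong_sym:
  assumes "add_subgroup K" "- a + b \<in> K"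
  shows "- b + a \<in> K"
  using add_subgroupD(3)[OF assms] by (simp add: minus_add)

lemma normal_subgroup_conj:
  assumes "normal_subgroup K G" "add_subgroup G" "g \<in> G" "k \<in> K"
  shows "g + k - g \<in> K" and "- g + k + g \<in> K"
proof -
  show *: "g + k - g \<in> K" using assms by (simp add: normal_subgroup_def)
  have "- g + k - (- g) \<in> K"
    using assms add_subgroupD(3)[of G g] by (simp only: normal_subgroup_def)
  then show "- g + k + g \<in> K" by simp
qed

lemma ex_maximal_normal_subgroup:
  assumes "add_subgroup G" "finite G" "G \<noteq> {0}"
  obtains K where "normal_subgroup K G" and "K \<noteq> G"
    and "\<And>A. normal_subgroup A G \<Longrightarrow> K \<subseteq> A \<Longrightarrow> A = K \<or> A = G"
proof -
  let ?P = "{K. normal_subgroup K G \<and> K \<noteq> G}"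
  have "{0} \<in> ?P"
    using assms by (auto simp: normal_subgroup_def add_subgroup_def)
  moreover have "finite ?P"
    by (rule finite_subset[of _ "Pow G"]) (auto simp: normal_subgroup_def assms(2))
  ultimately obtain K where "K \<in> ?P" "\<And>A. A \<in> ?P \<Longrightarrow> K \<subseteq> A \<Longrightarrow> K = A"
    using finite_has_maximal[of ?P] by blast
  then show ?thesis using that by blast
qed

definition translate :: "'g::plus \<Rightarrow> ('g \<Rightarrow> 's) \<Rightarrow> 'g \<Rightarrow> 's" where
  "translate a x = (\<lambda>g. x (g + a))"

lemma translate_simps [simp]:
  "translate a x g = x (g + a)"
  "translate 0 x = x" for a :: "'g::monoid_add"
  by (auto simp: translate_def)

lemma translate_translate: "translate a (translate b x) = translate (a + b) x" for a b :: "'g::semigroup_add"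
  by (simp add: translate_def add.assoc)

lemma translate_add:
  "translate a (x + y) = translate a x + translate a y"
  "translate a (- x) = - translate a x"
  for x y :: "'g::plus \<Rightarrow> 's::group_add"
  by (auto simp: translate_def fun_eq_iff)

text \<open>Compact subsets take finitely many values at every site, whatever the type of values;
  this replaces a finite alphabet.\<close>
abbreviation cantor :: "('i \<Rightarrow> 's) topology" where
  "cantor \<equiv> product_topology (\<lambda>_. discrete_topology UNIV) UNIV"

lemma closedin_cylinder: "closedin cantor {x. x g \<in> B}"
  using closedin_continuous_map_preimage[OF continuous_map_product_projection[of g UNIV "\<lambda>_. discrete_topology UNIV"], of B]
  by simp

lemma finite_values_compact:
  assumes "compactin cantor N"
  shows "finite ((\<lambda>n. n g) ` N)"
  using image_compactin[OF assms continuous_map_product_projection[of g UNIV "\<lambda>_. discrete_topology UNIV"]]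
  by (simp add: compactin_discrete_topology)

lemma compact_choice:
  assumes "compactin cantor N"
    and closed: "\<And>j. j \<in> J \<Longrightarrow> closedin cantor (A j)"
    and fin: "\<And>F. finite F \<Longrightarrow> F \<subseteq> J \<Longrightarrow> \<exists>n\<in>N. \<forall>j\<in>F. n \<in> A j"
  obtains n where "n \<in> N" and "\<forall>j\<in>J. n \<in> A j"
proof -
  have "N \<inter> \<Inter>(A ` J) \<noteq> {}"
  proof -
    have "N \<inter> \<Inter>\<F> \<noteq> {}" if F: "finite \<F>" "\<F> \<subseteq> A ` J" for \<F>
    proof -
      obtain F where "finite F" "F \<subseteq> J" "\<F> = A ` F"
        using finite_subset_image[OF F] by blast
      then show ?thesis using fin[of F] by auto
    qed
    moreover have "\<forall>C\<in>A ` J. closedin cantor C" using closed by blast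
    ultimately show ?thesis
      using assms(1) unfolding compactin_fip by (elim conjE allE[of _ "A ` J"]) simp
  qed
  then show ?thesis using that by blast
qed

locale shift_group =
  fixes \<Lambda> :: "'g::comm_ring_1 set" and N :: "('g \<Rightarrow> 's::group_add) set"
  assumes subgroup: "add_subgroup N"
    and translate: "a \<in> \<Lambda> \<Longrightarrow> n \<in> N \<Longrightarrow> translate a n \<in> N"
    and compact: "compactin cantor N"

definition values_in :: "('g \<Rightarrow> 's) set \<Rightarrow> 'g set \<Rightarrow> 's set \<Rightarrow> ('g \<Rightarrow> 's) set" where
  "values_in N Q K = {n \<in> N. \<forall>g\<in>Q. n g \<in> K}"

lemma shift_group_values_in:
  assumes "shift_group \<Lambda> N" "add_subgroup K" and Q: "\<And>g a. g \<in> Q \<Longrightarrow> a \<in> \<Lambda> \<Longrightarrow> g + a \<in> Q"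
  shows "shift_group \<Lambda> (values_in N Q K)"
proof
  interpret shift_group \<Lambda> N by fact
  note K = add_subgroupD[OF assms(2)]
  show "add_subgroup (values_in N Q K)"
    using K add_subgroupD[OF subgroup] by (auto simp: add_subgroup_def values_in_def)
  show "translate a n \<in> values_in N Q K" if "a \<in> \<Lambda>" "n \<in> values_in N Q K" for a n
    using that Q translate by (auto simp: values_in_def)
  have "values_in N Q K = N \<inter> \<Inter>((\<lambda>g. {x. x g \<in> K}) ` Q)"
    by (auto simp: values_in_def)
  moreover have "compactin cantor (N \<inter> \<Inter>((\<lambda>g. {x. x g \<in> K}) ` Q))"
  proof (cases "Q = {}")
    case False
    then show ?thesis
      by (intro compact_Int_closedin compact closedin_Inter) (auto intro: closedin_cylinder)
  qed (simp add: compact)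
  ultimately show "compactin cantor (values_in N Q K)" by simp
qed

text \<open>If the condition on \<open>E\<close> implies the condition on \<open>Q\<close>, then by compactness a finite part
  of \<open>E\<close> suffices for the implication to hold as far as the window \<open>W\<close> can see. This turns a
  correction term that is small modulo \<open>K\<close> into one that vanishes on \<open>W\<close>.\<close>
lemma values_in_local:
  assumes "shift_group \<Lambda> N" "add_subgroup K" "finite W"
    and det: "\<And>n. n \<in> N \<Longrightarrow> \<forall>g\<in>E. n g \<in> K \<Longrightarrow> \<forall>g\<in>Q. n g \<in> K"
  obtains V where "finite V" and "V \<subseteq> E"
    and "\<forall>m\<in>N. (\<forall>g\<in>V. m g \<in> K) \<longrightarrow> (\<exists>n\<in>values_in N Q K. \<forall>w\<in>W. n w = m w)"
proof -
  interpret shift_group \<Lambda> N by fact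
  \<comment> \<open>Otherwise compactness yields one \<open>m\<close> that violates the conclusion for all \<open>V\<close>; but \<open>m\<close> is in
    \<open>values_in N Q K\<close> and agrees with itself on \<open>W\<close>.\<close>
  have "\<exists>V. finite V \<and> V \<subseteq> E \<and>
    (\<forall>m\<in>N. (\<forall>g\<in>V. m g \<in> K) \<longrightarrow> (\<exists>n\<in>values_in N Q K. \<forall>w\<in>W. n w = m w))"
  proof (rule ccontr)
    assume "\<not> ?thesis"
    then have bad: "\<exists>m\<in>N. (\<forall>g\<in>V. m g \<in> K) \<and> (\<forall>n\<in>values_in N Q K. \<exists>w\<in>W. n w \<noteq> m w)"
      if "finite V" "V \<subseteq> E" for V
      using that by (auto simp: not_ex dest: spec[of _ V])
    define B where "B = (\<Inter>n\<in>values_in N Q K. \<Union>w\<in>W. {m. m w \<in> - {n w}})"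
    have B: "m \<in> B \<longleftrightarrow> (\<forall>n\<in>values_in N Q K. \<exists>w\<in>W. n w \<noteq> m w)" for m
      by (auto simp: B_def eq_commute)
    have "0 \<in> values_in N Q K"
      using add_subgroupD(1)[OF subgroup] add_subgroupD(1)[OF assms(2)] by (auto simp: values_in_def)
    moreover have "closedin cantor {m. m w \<noteq> s}" for w :: 'g and s :: 's
      using closedin_cylinder[of w "- {s}"] by simp
    ultimately have "closedin cantor B"
      unfolding B_def using assms(3)
      by (intro closedin_Inter) (auto intro!: closedin_Union)
    \<comment> \<open>The index \<open>None\<close> stands for the closed condition \<open>B\<close>, the others for the sites of \<open>E\<close>.\<close>
    let ?A = "\<lambda>j. case j of None \<Rightarrow> B | Some g \<Rightarrow> {x. x g \<in> K}"
    obtain m where m: "m \<in> N" "\<forall>j\<in>insert None (Some ` E). m \<in> ?A j"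
    proof (rule compact_choice[OF compact, of "insert None (Some ` E)" ?A])
      show "closedin cantor (?A j)" for j
        using \<open>closedin cantor B\<close> closedin_cylinder by (cases j) auto
      show "\<exists>n\<in>N. \<forall>j\<in>F. n \<in> ?A j" if F: "finite F" "F \<subseteq> insert None (Some ` E)" for F
      proof -
        have "finite {g. Some g \<in> F}"
          using finite_vimageI[OF F(1), of Some] by (simp add: vimage_def)
        moreover have "{g. Some g \<in> F} \<subseteq> E" using F(2) by auto
        ultimately have "\<exists>m\<in>N. (\<forall>g\<in>{g. Some g \<in> F}. m g \<in> K) \<and> m \<in> B"
          unfolding B by (rule bad)
        then obtain m where "m \<in> N" "\<forall>g\<in>{g. Some g \<in> F}. m g \<in> K" "m \<in> B"
          by blast
        then show ?thesis by (intro bexI[of _ m]) (auto split: option.split)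
      qed
    qed
    have "m \<in> B" using m(2) by simp
    moreover have "\<forall>g\<in>E. m g \<in> K" using m(2) by force
    then have "m \<in> values_in N Q K"
      using det m(1) by (simp add: values_in_def)
    ultimately show False using B by blast
  qed
  then show ?thesis using that by blast
qed

text \<open>The coset \<open>x + N\<close> is invariant under translation by \<open>k * \<Lambda>\<close>. For \<open>N = {0}\<close> this says
  that \<open>x\<close> itself is periodic.\<close>
definition periodic_mod :: "'g::comm_ring_1 set \<Rightarrow> int \<Rightarrow> ('g \<Rightarrow> 's::group_add) set \<Rightarrow> ('g \<Rightarrow> 's) \<Rightarrow> bool" where
  "periodic_mod \<Lambda> k N x \<longleftrightarrow> (\<forall>a\<in>\<Lambda>. - x + translate (of_int k * a) x \<in> N)"

lemma translate_cong_add: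
  assumes "shift_group \<Lambda> N" "a \<in> \<Lambda>" "- x + translate a x \<in> N" "m \<in> N"
  shows "- (x + m) + translate a (x + m) \<in> N"
proof -
  interpret shift_group \<Lambda> N by fact
  have "- (x + m) + translate a (x + m) = - m + ((- x + translate a x) + translate a m)"
    by (simp add: translate_add minus_add add.assoc diff_conv_add_uminus del: add_uminus_conv_diff)
  then show ?thesis
    using add_subgroupD[OF subgroup] assms translate by simp
qed

lemma periodic_mod_add:
  assumes "free_lattice d \<Lambda>" "shift_group \<Lambda> N" "periodic_mod \<Lambda> k N x" "m \<in> N"
  shows "periodic_mod \<Lambda> k N (x + m)"
  using assms translate_cong_add[OF assms(2)] lattice_closed(3)[OF assms(1)]
  by (simp add: periodic_mod_def)

lemma periodic_mod_mult:
  assumes "free_lattice d \<Lambda>" "periodic_mod \<Lambda> k N x"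
  shows "periodic_mod \<Lambda> (k * j) N x"
  unfolding periodic_mod_def
proof
  fix a assume "a \<in> \<Lambda>"
  then have "of_int j * a \<in> \<Lambda>" by (rule lattice_closed(3)[OF assms(1)])
  then have "- x + translate (of_int k * (of_int j * a)) x \<in> N"
    using assms(2) by (simp add: periodic_mod_def)
  then show "- x + translate (of_int (k * j) * a) x \<in> N" by (simp add: mult.assoc)
qed

text \<open>The translations in \<open>\<Lambda>\<close> that preserve the coset \<open>x + N\<close> form a subgroup.\<close>
lemma stabilizer_closed:
  assumes "free_lattice d \<Lambda>" "shift_group \<Lambda> N" "a \<in> \<Lambda>" "- x + translate a x \<in> N"
  shows "b \<in> \<Lambda> \<Longrightarrow> - x + translate b x \<in> N \<Longrightarrow> - x + translate (a + b) x \<in> N"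
    and "- x + translate (of_int k * a) x \<in> N"
proof -
  interpret shift_group \<Lambda> N by fact
  note L = lattice_closed[OF assms(1)] lattice_minus[OF assms(1)]
  have add: "- x + translate (a + b) x \<in> N" if a: "a \<in> \<Lambda>" "- x + translate a x \<in> N"
    and b: "b \<in> \<Lambda>" "- x + translate b x \<in> N" for a b
  proof -
    have "- translate a x + translate (a + b) x \<in> N"
      using translate[OF a(1) b(2)] by (simp add: translate_add translate_translate)
    then show ?thesis by (rule left_cong_trans[OF subgroup a(2)])
  qed
  show "b \<in> \<Lambda> \<Longrightarrow> - x + translate b x \<in> N \<Longrightarrow> - x + translate (a + b) x \<in> N"
    using add assms(3,4) by blast
  have neg: "- x + translate (- a) x \<in> N"
    using translate[OF L(4) left_cong_sym[OF subgroup assms(4)], OF assms(3)]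
    by (simp add: translate_add translate_translate)
  show "- x + translate (of_int k * a) x \<in> N"
  proof (induction k rule: int_induct[where k = 0])
    case base
    show ?case using add_subgroupD(1)[OF subgroup] by (simp add: zero_fun_def)
  next
    case (step1 i)
    have "of_int (i + 1) * a = of_int i * a + a" by (simp add: algebra_simps)
    then show ?case using add[OF L(3)[OF assms(3)] step1(2) assms(3,4)] by metis
  next
    case (step2 i)
    have "of_int (i - 1) * a = of_int i * a + - a" by (simp add: algebra_simps)
    then show ?case
      using add[OF L(3)[OF assms(3)] step2(2) L(4)[OF assms(3)] neg] by metis
  qed
qed

definition coset :: "'g::minus \<Rightarrow> 'g set \<Rightarrow> 'g set" where
  "coset c \<Lambda> = {g. g - c \<in> \<Lambda>}"

lemma coset_add:
  assumes "free_lattice d \<Lambda>" "g \<in> coset c \<Lambda>" "a \<in> \<Lambda>"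
  shows "g + a \<in> coset c \<Lambda>"
  using lattice_closed(2)[OF assms(1), of "g - c" a] assms(2,3) by (simp add: coset_def algebra_simps)

text \<open>Translation invariance makes the group of values constant along an orbit.\<close>
lemma values_coset:
  assumes "free_lattice d \<Lambda>" "shift_group \<Lambda> N" "g \<in> coset c \<Lambda>"
  shows "(\<lambda>n. n g) ` N = (\<lambda>n. n c) ` N"
proof -
  interpret shift_group \<Lambda> N by fact
  have a: "g - c \<in> \<Lambda>" "- (g - c) \<in> \<Lambda>"
    using assms(3) lattice_minus(1)[OF assms(1)] unfolding coset_def by blast+
  have "n g \<in> (\<lambda>n. n c) ` N" "n c \<in> (\<lambda>n. n g) ` N" if "n \<in> N" for n
    using imageI[OF translate[OF a(1) that], of "\<lambda>n. n c"] imageI[OF translate[OF a(2) that], of "\<lambda>n. n g"]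
    by simp_all
  then show ?thesis by blast
qed

lemma values_subgroup: "add_subgroup N \<Longrightarrow> add_subgroup ((\<lambda>n. n g) ` N)"
  unfolding add_subgroup_def
  by (auto intro: image_eqI[of _ _ "0"] image_eqI[of _ _ "_ + _"] image_eqI[of _ _ "- _"])

section \<open>Patterns modulo a maximal normal subgroup\<close>

text \<open>Every pattern on \<open>W\<close> with entries in \<open>G / K\<close> is the image of a member of \<open>N\<close>.\<close>
definition realises_all :: "('g \<Rightarrow> 's::group_add) set \<Rightarrow> 's set \<Rightarrow> 's set \<Rightarrow> 'g set \<Rightarrow> bool" where
  "realises_all N K G W \<longleftrightarrow> (\<forall>p. (\<forall>w\<in>W. p w \<in> G) \<longrightarrow> (\<exists>n\<in>N. \<forall>w\<in>W. - p w + n w \<in> K))"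

text \<open>The values at \<open>w\<close> of those members of \<open>N\<close> that are trivial modulo \<open>K\<close> on the rest of \<open>W\<close>
  make up, together with \<open>K\<close>, a normal subgroup \<open>A\<close> of \<open>G\<close>: conjugation by \<open>g\<close> can be carried out in \<open>N\<close>,
  using a member with value \<open>g\<close> at \<open>w\<close>. By maximality of \<open>K\<close> either \<open>A = K\<close>, which is the claim, or
  \<open>A = G\<close>. In the second case any pattern on \<open>W\<close> could be realised, first on \<open>W - {w}\<close> and then at
  \<open>w\<close> without disturbing the other sites.\<close>
lemma minimal_unrealised_determines:
  assumes N: "add_subgroup N" and G: "add_subgroup G" and K: "normal_subgroup K G"
    and maximal: "\<And>A. normal_subgroup A G \<Longrightarrow> K \<subseteq> A \<Longrightarrow> A = K \<or> A = G"
    and vals: "\<And>g. g \<in> W \<Longrightarrow> (\<lambda>n. n g) ` N = G"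
    and bad: "\<not> realises_all N K G W" and "w \<in> W" and good: "realises_all N K G (W - {w})"
    and n: "n \<in> N" "\<And>v. v \<in> W - {w} \<Longrightarrow> n v \<in> K"
  shows "n w \<in> K"
proof -
  note NN = add_subgroupD[OF N] and GG = add_subgroupD[OF G]
  have Ksub: "add_subgroup K" "K \<subseteq> G" using K by (auto simp: normal_subgroup_def)
  note KK = add_subgroupD[OF Ksub(1)] and conj = normal_subgroup_conj[OF K G]
  have inG: "m g \<in> G" if "m \<in> N" "g \<in> W" for m g
    using vals[OF that(2)] that(1) by blast
  define A where "A = {g \<in> G. \<exists>m\<in>N. (\<forall>v\<in>W - {w}. m v \<in> K) \<and> - g + m w \<in> K}"
  have "normal_subgroup A G"
    unfolding normal_subgroup_def add_subgroup_def
  proof (intro conjI ballI)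
    show "0 \<in> A"
      using GG(1) NN(1) KK(1) by (auto simp: A_def intro!: bexI[of _ 0])
    show "A \<subseteq> G" by (auto simp: A_def)
    fix a assume "a \<in> A"
    then obtain m where a: "a \<in> G" and m: "m \<in> N" "\<forall>v\<in>W - {w}. m v \<in> K" "- a + m w \<in> K"
      by (auto simp: A_def)
    show "- a \<in> A"
    proof -
      have "a + - (- a + m w) - a \<in> K"
        using conj(1)[OF a KK(3)[OF m(3)]] .
      then have "- (- a) + (- m) w \<in> K"
        by (simp add: minus_add add.assoc diff_conv_add_uminus del: add_uminus_conv_diff)
      moreover have "\<forall>v\<in>W - {w}. (- m) v \<in> K"
        using m(2) KK(3) by simp
      ultimately show ?thesis
        unfolding A_def using GG(3)[OF a] NN(3)[OF m(1)] by blast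
    qed
    fix b assume "b \<in> A"
    then obtain m' where b: "b \<in> G" and m': "m' \<in> N" "\<forall>v\<in>W - {w}. m' v \<in> K" "- b + m' w \<in> K"
      by (auto simp: A_def)
    show "a + b \<in> A"
    proof -
      have "(- b + (- a + m w) + b) + (- b + m' w) \<in> K"
        using conj(2)[OF b m(3)] m'(3) KK(2) by blast
      then have "- (a + b) + (m + m') w \<in> K"
        by (simp add: minus_add add.assoc diff_conv_add_uminus del: add_uminus_conv_diff)
      moreover have "\<forall>v\<in>W - {w}. (m + m') v \<in> K"
        using m(2) m'(2) KK(2) by simp
      ultimately show ?thesis
        unfolding A_def using GG(2)[OF a b] NN(2)[OF m(1) m'(1)] by blast
    qed
  next
    fix g a assume g: "g \<in> G" and "a \<in> A"
    then obtain m where a: "a \<in> G" and m: "m \<in> N" "\<forall>v\<in>W - {w}. m v \<in> K" "- a + m w \<in> K"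
      by (auto simp: A_def)
    obtain c where c: "c \<in> N" "c w = g" using vals[OF \<open>w \<in> W\<close>] g by blast
    have "- (g + a - g) + (c + m - c) w = g + (- a + m w) - g"
      by (simp add: c(2) minus_add add.assoc diff_conv_add_uminus del: add_uminus_conv_diff)
    then have "- (g + a - g) + (c + m - c) w \<in> K"
      using conj(1)[OF g m(3)] by simp
    moreover have "\<forall>v\<in>W - {w}. (c + m - c) v \<in> K"
      using m(2) conj(1)[OF inG[OF c(1)]] by simp
    moreover have "c + m - c \<in> N" "g + a - g \<in> G"
      using NN(4)[OF NN(2)[OF c(1) m(1)] c(1)] GG(4)[OF GG(2)[OF g a] g] by simp_all
    ultimately show "g + a - g \<in> A" unfolding A_def by blast
  qed
  moreover have "K \<subseteq> A"
    using Ksub(2) NN(1) KK by (auto simp: A_def intro!: bexI[of _ 0])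
  moreover have "A \<noteq> G"
  proof
    assume "A = G"
    have "realises_all N K G W"
      unfolding realises_all_def
    proof (intro allI impI)
      fix p assume p: "\<forall>w\<in>W. p w \<in> G"
      then obtain m where m: "m \<in> N" "\<forall>v\<in>W - {w}. - p v + m v \<in> K"
        using good unfolding realises_all_def by (metis DiffD1)
      have "- m w + p w \<in> A"
        unfolding \<open>A = G\<close> using p \<open>w \<in> W\<close> by (intro GG(2) GG(3) inG[OF m(1)]) auto
      then obtain m' where m': "m' \<in> N" "\<forall>v\<in>W - {w}. m' v \<in> K" "- (- m w + p w) + m' w \<in> K"
        by (auto simp: A_def)
      have "- p v + (m + m') v \<in> K" if "v \<in> W" for v
      proof (cases "v = w")
        case True
        then show ?thesis using m'(3) by (simp add: minus_add add.assoc)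
      next
        case False
        then have "(- p v + m v) + m' v \<in> K" using m(2) m'(2) that by (intro KK(2)[of "- p v + m v"]) auto
        then show ?thesis by (simp add: add.assoc)
      qed
      then show "\<exists>n\<in>N. \<forall>w\<in>W. - p w + n w \<in> K"
        using NN(2)[OF m(1) m'(1)] by blast
    qed
    with bad show False by contradiction
  qed
  ultimately have "A = K" using maximal by blast
  moreover have "n w \<in> A"
    using n inG \<open>w \<in> W\<close> KK(1) by (auto simp: A_def intro!: bexI[of _ n])
  ultimately show ?thesis by simp
qed

lemma realises_all_infinite:
  assumes "compactin cantor N" and "\<And>F. finite F \<Longrightarrow> F \<subseteq> Q \<Longrightarrow> realises_all N K G F"
  shows "realises_all N K G Q"
  unfolding realises_all_def
proof (intro allI impI)
  fix p assume p: "\<forall>w\<in>Q. p w \<in> G"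
  obtain n where "n \<in> N" "\<forall>g\<in>Q. n \<in> {n. n g \<in> {s. - p g + s \<in> K}}"
  proof (rule compact_choice[OF assms(1), of Q "\<lambda>g. {n. n g \<in> {s. - p g + s \<in> K}}"])
    show "closedin cantor {n. n g \<in> {s. - p g + s \<in> K}}" for g
      by (rule closedin_cylinder)
    show "\<exists>n\<in>N. \<forall>g\<in>F. n \<in> {n. n g \<in> {s. - p g + s \<in> K}}" if "finite F" "F \<subseteq> Q" for F
      using assms(2)[OF that] p that(2) by (auto simp: realises_all_def)
  qed
  then show "\<exists>n\<in>N. \<forall>w\<in>Q. - p w + n w \<in> K" by auto
qed

text \<open>Let the width \<open>r\<close> of the strip be the difference in height between the highest and the
  lowest site of \<open>W\<close>. If all sites of a translate of \<open>W\<close> but the highest lie in the strip, then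
  the value at the highest is trivial modulo \<open>K\<close> as well, and likewise for the lowest. So the
  strip on which \<open>n\<close> is trivial modulo \<open>K\<close> can be widened by one in both directions, again and
  again.\<close>
lemma strip_determines:
  fixes l :: "'g::comm_ring_1 \<Rightarrow> int"
  assumes L: "free_lattice d \<Lambda>" and "shift_group \<Lambda> N" and l: "additive_on \<Lambda> l"
    and W: "finite W" "W \<noteq> {}" "W \<subseteq> coset c \<Lambda>" "inj_on (\<lambda>w. l (w - c)) W"
    and det: "\<And>w n. w \<in> W \<Longrightarrow> n \<in> N \<Longrightarrow> \<forall>v\<in>W - {w}. n v \<in> K \<Longrightarrow> n w \<in> K"
  obtains r where "\<forall>n\<in>N. (\<forall>g\<in>{g \<in> coset c \<Lambda>. 0 \<le> l (g - c) \<and> l (g - c) < r}. n g \<in> K)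
      \<longrightarrow> (\<forall>g\<in>coset c \<Lambda>. n g \<in> K)"
proof -
  interpret shift_group \<Lambda> N by fact
  define ht where "ht g = l (g - c)" for g
  have "finite (ht ` W)" "ht ` W \<noteq> {}" using W by auto
  then have "Max (ht ` W) \<in> ht ` W" "Min (ht ` W) \<in> ht ` W"
    by (rule Max_in, rule Min_in)
  then obtain top bot where tb: "top \<in> W" "Max (ht ` W) = ht top" "bot \<in> W" "Min (ht ` W) = ht bot"
    by blast
  have top: "top \<in> W" "\<forall>w\<in>W. ht w \<le> ht top" and bot: "bot \<in> W" "\<forall>w\<in>W. ht bot \<le> ht w"
    using tb Max_ge[OF \<open>finite (ht ` W)\<close>] Min_le[OF \<open>finite (ht ` W)\<close>] by auto
  define r where "r = ht top - ht bot"
  note add = additive_on_lattice[OF L l]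
  have shift: "g + (g' - w) \<in> coset c \<Lambda>" "ht (g + (g' - w)) = ht g + ht g' - ht w" "g' - w \<in> \<Lambda>"
    if "g \<in> coset c \<Lambda>" "g' \<in> coset c \<Lambda>" "w \<in> coset c \<Lambda>" for g g' w
  proof -
    have in\<Lambda>: "g - c \<in> \<Lambda>" "g' - c \<in> \<Lambda>" "w - c \<in> \<Lambda>" using that by (auto simp: coset_def)
    have "(g' - c) - (w - c) \<in> \<Lambda>"
      using lattice_minus(2)[OF L in\<Lambda>(3,2)] .
    then show *: "g' - w \<in> \<Lambda>" by simp
    show "g + (g' - w) \<in> coset c \<Lambda>" by (rule coset_add[OF L that(1) *])
    have "l (g' - w) = l (g' - c) - l (w - c)"
      using add(4)[OF in\<Lambda>(3,2)] by simp
    moreover have "l ((g - c) + (g' - w)) = l (g - c) + l (g' - w)"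
      by (rule add(1)[OF in\<Lambda>(1) *])
    moreover have "(g - c) + (g' - w) = g + (g' - w) - c" by simp
    ultimately show "ht (g + (g' - w)) = ht g + ht g' - ht w"
      unfolding ht_def by (simp only:)
  qed
  have main: "\<forall>g\<in>coset c \<Lambda>. n g \<in> K"
    if n: "n \<in> N" "\<forall>g\<in>{g \<in> coset c \<Lambda>. 0 \<le> l (g - c) \<and> l (g - c) < r}. n g \<in> K" for n
  proof -
    have "\<forall>g\<in>coset c \<Lambda>. - int j \<le> ht g \<and> ht g < r + int j \<longrightarrow> n g \<in> K" for j
    proof (induction j)
      case 0
      then show ?case using n(2) by (simp add: ht_def)
    next
      case (Suc j)
      \<comment> \<open>\<open>W\<close> is moved so that its site \<open>w\<close>, the top or the bottom one, comes to lie at \<open>g\<close>.\<close>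
      have step: "n g \<in> K" if g: "g \<in> coset c \<Lambda>" and w: "w \<in> W"
        and others: "\<And>v. v \<in> W - {w} \<Longrightarrow> - int j \<le> ht v + ht g - ht w \<and> ht v + ht g - ht w < r + int j" for g w
      proof -
        have wQ: "w \<in> coset c \<Lambda>" using w W(3) by blast
        have "n (v + (g - w)) \<in> K" if "v \<in> W - {w}" for v
          using Suc.IH shift(1,2)[OF _ g wQ, of v] others[OF that] that W(3) by auto
        then have "translate (g - w) n w \<in> K"
          using det[OF w translate[OF shift(3)[OF g g wQ] n(1)]] by simp
        then show ?thesis by simp
      qed
      have lt: "v \<in> W - {top} \<Longrightarrow> ht v < ht top" "v \<in> W - {bot} \<Longrightarrow> ht bot < ht v" for v
        using top bot W(4) by (auto simp: ht_def inj_on_def order_less_le)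
      show ?case
      proof (intro ballI impI)
        fix g assume g: "g \<in> coset c \<Lambda>" and "- int (Suc j) \<le> ht g \<and> ht g < r + int (Suc j)"
        then consider "- int j \<le> ht g \<and> ht g < r + int j" | "ht g = r + int j" | "ht g = - int j - 1"
          by linarith
        then show "n g \<in> K"
        proof cases
          case 1
          then show ?thesis using Suc.IH g by blast
        next
          case 2
          have "- int j \<le> ht v + ht g - ht top \<and> ht v + ht g - ht top < r + int j" if "v \<in> W - {top}" for v
            using lt(1)[OF that] bot(2)[rule_format, of v] that 2 r_def by simp
          then show ?thesis by (rule step[OF g top(1)])
        next
          case 3
          have "- int j \<le> ht v + ht g - ht bot \<and> ht v + ht g - ht bot < r + int j" if "v \<in> W - {bot}" for v
            using lt(2)[OF that] top(2)[rule_format, of v] that 3 r_def by simp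
          then show ?thesis by (rule step[OF g bot(1)])
        qed
      qed
    qed
    moreover have "\<exists>j. - int j \<le> ht g \<and> ht g < r + int j" for g
    proof -
      have "int (nat (\<bar>ht g\<bar> + \<bar>r\<bar> + 1)) = \<bar>ht g\<bar> + \<bar>r\<bar> + 1" by simp
      then show ?thesis by (intro exI[of _ "nat (\<bar>ht g\<bar> + \<bar>r\<bar> + 1)"]) linarith
    qed
    ultimately show ?thesis by blast
  qed
  show ?thesis
    by (rule that[of r], intro ballI impI) (rule bspec[OF main])
qed

section \<open>Periodic points modulo a smaller group\<close>

text \<open>When \<open>N\<close> realises all patterns modulo \<open>K\<close>, the values of \<open>x\<close> on the orbit may be replaced,
  modulo \<open>K\<close>, by those of a configuration \<open>x \<circ> rep\<close> with period \<open>k'\<close>. Here \<open>rep\<close> picks a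
  representative in each class modulo \<open>k' * \<Lambda>\<close> and fixes the sites of \<open>V\<close>, so that nothing changes
  there. For this the sites of \<open>V\<close> must be pairwise incongruent, which holds once \<open>k'\<close> exceeds the
  differences of their heights. As \<open>k\<close> divides \<open>k'\<close>, the correction has values in \<open>G\<close>.\<close>
lemma periodic_descent_free:
  assumes L: "free_lattice (Suc d) \<Lambda>" and N: "shift_group \<Lambda> N" and K: "add_subgroup K"
    and full: "\<And>F. finite F \<Longrightarrow> F \<subseteq> coset c \<Lambda> \<Longrightarrow> realises_all N K ((\<lambda>n. n c) ` N) F"
    and x: "periodic_mod \<Lambda> k N x" "k > 0" and V: "finite V" "V \<subseteq> coset c \<Lambda>"
  shows "\<exists>m\<in>N. \<exists>k'>0. (\<forall>g\<in>V. m g \<in> K) \<and> periodic_mod \<Lambda> k' (values_in N (coset c \<Lambda>) K) (x + m)"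
proof -
  interpret shift_group \<Lambda> N by fact
  note cl = lattice_closed[OF L] lattice_minus[OF L]
  have "finite ((\<lambda>w. w - c) ` V)" "(\<lambda>w. w - c) ` V \<subseteq> \<Lambda>"
    using V by (auto simp: coset_def)
  then obtain l v where v: "v \<in> \<Lambda>" "l v = (1::int)" and l: "additive_on \<Lambda> l"
    and inj: "inj_on l ((\<lambda>w. w - c) ` V)" and ker: "free_lattice d {a \<in> \<Lambda>. l a = 0}"
    by (rule lattice_height[OF L])
  obtain B where B: "B > 0" "\<forall>v\<in>V. \<forall>w\<in>V. \<bar>l (v - c) - l (w - c)\<bar> < B"
    using bounded_differences[OF V(1)] .
  define k' where "k' = k * B"
  have k': "k' > 0" "B \<le> k'" using x(2) B(1) by (auto simp: k'_def)
  define E where "E g g' \<longleftrightarrow> (\<exists>b\<in>\<Lambda>. g - g' = of_int k' * b)" for g g'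
  have E_distinct: "w = w'" if w: "w \<in> V" "w' \<in> V" "E w w'" for w w'
  proof -
    obtain b where b: "b \<in> \<Lambda>" "w - w' = of_int k' * b" using w(3) by (auto simp: E_def)
    have in\<Lambda>: "w - c \<in> \<Lambda>" "w' - c \<in> \<Lambda>" using w V(2) by (auto simp: coset_def)
    have "(w - c) - (w' - c) = of_int k' * b" using b(2) by simp
    then have eq: "l (w - c) - l (w' - c) = k' * l b"
      using additive_on_lattice(4)[OF L l in\<Lambda>(2,1)] additive_on_lattice(5)[OF L l b(1), of k'] by simp
    have "\<bar>l b\<bar> < 1"
    proof (rule ccontr)
      assume "\<not> ?thesis"
      then have "k' * 1 \<le> k' * \<bar>l b\<bar>" using k'(1) by (intro mult_left_mono) auto
      moreover have "k' * \<bar>l b\<bar> = \<bar>k' * l b\<bar>" using k'(1) by (simp add: abs_mult)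
      moreover have "\<bar>k' * l b\<bar> < B" using B(2) w(1,2) unfolding eq[symmetric] by blast
      ultimately show False using k'(2) by linarith
    qed
    then have "l (w - c) = l (w' - c)" using eq by simp
    then have "w - c = w' - c" using inj w(1,2) by (auto dest: inj_onD)
    then show ?thesis by simp
  qed
  define rep where "rep g = (SOME g'. E g g' \<and> ((\<exists>w\<in>V. E g w) \<longrightarrow> g' \<in> V))" for g
  have E_refl: "E g g" for g using cl(1) by (auto simp: E_def intro!: bexI[of _ 0])
  have rep: "E g (rep g) \<and> ((\<exists>w\<in>V. E g w) \<longrightarrow> rep g \<in> V)" for g
    unfolding rep_def by (rule someI_ex) (use E_refl in blast)
  have rep_V: "rep w = w" if "w \<in> V" for w
  proof -
    have "rep w \<in> V" using rep E_refl that by blast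
    then show ?thesis using E_distinct[OF that] rep by metis
  qed
  have E_shift: "E (g + of_int k' * a) g' \<longleftrightarrow> E g g'" if "a \<in> \<Lambda>" for g g' a
  proof
    assume "E g g'"
    then obtain b where "b \<in> \<Lambda>" "g - g' = of_int k' * b" by (auto simp: E_def)
    then have "g + of_int k' * a - g' = of_int k' * (b + a)" by (simp add: algebra_simps)
    then show "E (g + of_int k' * a) g'"
      using cl(2)[OF \<open>b \<in> \<Lambda>\<close> that] unfolding E_def by blast
  next
    assume "E (g + of_int k' * a) g'"
    then obtain b where "b \<in> \<Lambda>" "g + of_int k' * a - g' = of_int k' * b" by (auto simp: E_def)
    then have "g - g' = of_int k' * (b - a)" by (simp add: algebra_simps)
    then show "E g g'"
      using cl(5)[OF that \<open>b \<in> \<Lambda>\<close>] unfolding E_def by blast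
  qed
  have rep_shift: "rep (g + of_int k' * a) = rep g" if "a \<in> \<Lambda>" for g a
    unfolding rep_def E_shift[OF that] ..
  define p where "p g = - x g + x (rep g)" for g
  have p: "p g \<in> (\<lambda>n. n c) ` N" if "g \<in> coset c \<Lambda>" for g
  proof -
    obtain b where b: "b \<in> \<Lambda>" "g - rep g = of_int k' * b" using rep by (auto simp: E_def)
    have "rep g = g + of_int k * (of_int (- B) * b)"
      using b(2) by (simp add: k'_def algebra_simps)
    then have "p g = (- x + translate (of_int k * (of_int (- B) * b)) x) g"
      by (simp add: p_def)
    moreover have "- x + translate (of_int k * (of_int (- B) * b)) x \<in> N"
      using x(1) cl(3)[OF b(1)] unfolding periodic_mod_def by blast
    ultimately have "p g \<in> (\<lambda>n. n g) ` N" by blast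
    then show ?thesis using values_coset[OF L N that] by simp
  qed
  have "realises_all N K ((\<lambda>n. n c) ` N) (coset c \<Lambda>)"
    using full by (rule realises_all_infinite[OF compact])
  then obtain m where m: "m \<in> N" "\<forall>g\<in>coset c \<Lambda>. - p g + m g \<in> K"
    using p unfolding realises_all_def by blast
  have "\<forall>g\<in>V. m g \<in> K"
  proof
    fix g assume "g \<in> V"
    then have "- p g + m g \<in> K" "rep g = g" using m(2) V(2) rep_V by blast+
    moreover from this have "p g = 0" by (simp add: p_def)
    ultimately show "m g \<in> K" by simp
  qed
  moreover have "periodic_mod \<Lambda> k' (values_in N (coset c \<Lambda>) K) (x + m)"
    unfolding periodic_mod_def
  proof
    fix a assume a: "a \<in> \<Lambda>"
    have "periodic_mod \<Lambda> k' N (x + m)"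
      unfolding k'_def by (intro periodic_mod_add[OF L N] periodic_mod_mult[OF L] x(1) m(1))
    then have "- (x + m) + translate (of_int k' * a) (x + m) \<in> N"
      using a by (simp add: periodic_mod_def)
    moreover have "(- (x + m) + translate (of_int k' * a) (x + m)) g \<in> K" if g: "g \<in> coset c \<Lambda>" for g
    proof -
      let ?g = "g + of_int k' * a"
      have "?g \<in> coset c \<Lambda>" using coset_add[OF L g cl(3)[OF a]] .
      have near: "- x (rep g) + (x + m) g \<in> K" if "g \<in> coset c \<Lambda>" for g
        using bspec[OF m(2) that] by (simp add: p_def minus_add add.assoc)
      have "- (x + m) g + x (rep g) \<in> K"
        by (rule left_cong_sym[OF K near[OF g]])
      moreover have "- x (rep g) + (x + m) ?g \<in> K"
        using near[OF \<open>?g \<in> coset c \<Lambda>\<close>] unfolding rep_shift[OF a] .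
      ultimately have "- (x + m) g + (x + m) ?g \<in> K"
        by (rule left_cong_trans[OF K])
      then show ?thesis by simp
    qed
    ultimately show "- (x + m) + translate (of_int k' * a) (x + m) \<in> values_in N (coset c \<Lambda>) K"
      unfolding values_in_def by blast
  qed
  ultimately show ?thesis using m(1) k'(1) by blast
qed

definition restrict_to :: "'g set \<Rightarrow> ('g \<Rightarrow> 's::zero) \<Rightarrow> 'g \<Rightarrow> 's" where
  "restrict_to E n = (\<lambda>g. if g \<in> E then n g else 0)"

lemma restrict_to_add:
  "restrict_to E (x + y) = restrict_to E x + restrict_to E y"
  "restrict_to E (- x) = - restrict_to E x"
  "restrict_to E 0 = 0"
  for x y :: "'g \<Rightarrow> 's::group_add"
  by (auto simp: restrict_to_def fun_eq_iff)

lemma translate_restrict_to: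
  assumes "\<And>g. g + a \<in> E \<longleftrightarrow> g \<in> E"
  shows "translate a (restrict_to E x) = restrict_to E (translate a x)"
  using assms by (auto simp: restrict_to_def translate_def fun_eq_iff)

lemma shift_group_restrict_to:
  assumes "shift_group \<Lambda> N" and "\<Lambda>' \<subseteq> \<Lambda>" and E: "\<And>g a. a \<in> \<Lambda>' \<Longrightarrow> g + a \<in> E \<longleftrightarrow> g \<in> E"
  shows "shift_group \<Lambda>' (restrict_to E ` N)"
proof
  interpret shift_group \<Lambda> N by fact
  show "add_subgroup (restrict_to E ` N)"
    unfolding add_subgroup_def
  proof (intro conjI ballI)
    show "0 \<in> restrict_to E ` N"
      using imageI[OF add_subgroupD(1)[OF subgroup], of "restrict_to E"] by (simp add: restrict_to_add)
    fix a assume "a \<in> restrict_to E ` N"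
    then obtain m where m: "m \<in> N" "a = restrict_to E m" by blast
    show "- a \<in> restrict_to E ` N"
      using imageI[OF add_subgroupD(3)[OF subgroup m(1)], of "restrict_to E"] by (simp add: m(2) restrict_to_add)
    fix b assume "b \<in> restrict_to E ` N"
    then obtain n where n: "n \<in> N" "b = restrict_to E n" by blast
    show "a + b \<in> restrict_to E ` N"
      using imageI[OF add_subgroupD(2)[OF subgroup m(1) n(1)], of "restrict_to E"]
      by (simp add: m(2) n(2) restrict_to_add)
  qed
  show "translate a n \<in> restrict_to E ` N" if a: "a \<in> \<Lambda>'" and n: "n \<in> restrict_to E ` N" for a n
  proof -
    obtain m where m: "m \<in> N" "n = restrict_to E m" using n by blast
    have "translate a m \<in> N" using translate m(1) a assms(2) by blast
    then show ?thesis
      unfolding m(2) translate_restrict_to[of a E, OF E[OF a]] by (rule imageI)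
  qed
  have "continuous_map cantor cantor (restrict_to E :: ('a \<Rightarrow> 'b) \<Rightarrow> _)"
    unfolding continuous_map_componentwise_UNIV restrict_to_def
    by (auto intro: continuous_map_product_projection)
  then show "compactin cantor (restrict_to E ` N)"
    by (rule image_compactin[OF compact])
qed

text \<open>Together with finiteness of \<open>D\<close>, this says that only finitely many orbits of \<open>\<Lambda>\<close> matter.\<close>
definition supported_on :: "'g::minus set \<Rightarrow> 'g set \<Rightarrow> ('g \<Rightarrow> 's::zero) set \<Rightarrow> bool" where
  "supported_on \<Lambda> D N \<longleftrightarrow> (\<forall>n\<in>N. \<forall>g. n g \<noteq> 0 \<longrightarrow> (\<exists>c\<in>D. g \<in> coset c \<Lambda>))"

text \<open>The induction hypothesis on the rank \<open>d\<close>: the periodic points lie dense in every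
  invariant coset \<open>x + N\<close>. All sublattices of rank \<open>d\<close> of one ambient group are covered, so that
  the kernel of a height and the strips on which it acts fit in without change of coordinates. The
  type argument fixes the types of sites and values, which do not change in the induction.\<close>
definition periodic_approximation :: "nat \<Rightarrow> ('g::comm_ring_1 \<Rightarrow> 's::group_add) itself \<Rightarrow> bool" where
  "periodic_approximation d _ \<longleftrightarrow>
    (\<forall>\<Lambda> (N :: ('g \<Rightarrow> 's) set) D x k W. free_lattice d \<Lambda> \<longrightarrow> shift_group \<Lambda> N \<longrightarrow>
      finite D \<longrightarrow> supported_on \<Lambda> D N \<longrightarrow> periodic_mod \<Lambda> k N x \<longrightarrow> k > 0 \<longrightarrow> finite W \<longrightarrow>
      (\<exists>m\<in>N. \<exists>k'>0. (\<forall>w\<in>W. m w = 0) \<and> periodic_mod \<Lambda> k' {0} (x + m)))"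

lemma periodic_mod_zeroD:
  assumes "periodic_mod \<Lambda> k {0} x" "a \<in> \<Lambda>"
  shows "x (g + of_int k * a) = x g"
proof -
  have "- x + translate (of_int k * a) x = 0"
    using assms by (simp add: periodic_mod_def)
  from fun_cong[OF this, of g] have "- x g + x (g + of_int k * a) = 0"
    by simp
  then have "x g + (- x g + x (g + of_int k * a)) = x g" by simp
  then show ?thesis by simp
qed

text \<open>Restricted to the strip, the coset \<open>x + N\<close> is acted upon by the kernel \<open>\<Lambda>'\<close> of the height
  with finitely many orbits. The induction hypothesis yields \<open>z\<close> in \<open>x + N\<close> whose restriction is periodic,
  and as the strip determines everything modulo \<open>K\<close>, the class of \<open>z\<close> modulo the smaller group
  \<open>M\<close> is periodic along \<open>\<Lambda>'\<close>. Translation by \<open>k * v\<close> preserves this property as well as the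
  coset \<open>x + N\<close>, and a class in \<open>x + N\<close> having it is determined by the values at finitely many sites of the strip. So two of the
  translates of \<open>z\<close> along \<open>v\<close> are congruent modulo \<open>M\<close>.\<close>
lemma periodic_descent_strip:
  fixes N :: "('g::comm_ring_1 \<Rightarrow> 's::group_add) set"
  assumes IH: "periodic_approximation d TYPE('g \<Rightarrow> 's)"
    and L: "free_lattice (Suc d) \<Lambda>" and N: "shift_group \<Lambda> N" and K: "add_subgroup K"
    and l: "additive_on \<Lambda> l" and v: "v \<in> \<Lambda>" "l v = (1::int)" and ker: "free_lattice d {a \<in> \<Lambda>. l a = 0}"
    and det: "\<And>n. n \<in> N \<Longrightarrow> \<forall>g\<in>{g \<in> coset c \<Lambda>. 0 \<le> l (g - c) \<and> l (g - c) < r}. n g \<in> K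
      \<Longrightarrow> \<forall>g\<in>coset c \<Lambda>. n g \<in> K"
    and x: "periodic_mod \<Lambda> k N x" "k > 0"
    and V: "finite V"
  shows "\<exists>m\<in>N. \<exists>k'>0. (\<forall>g\<in>V \<inter> {g \<in> coset c \<Lambda>. 0 \<le> l (g - c) \<and> l (g - c) < r}. m g \<in> K)
    \<and> periodic_mod \<Lambda> k' (values_in N (coset c \<Lambda>) K) (x + m)"
proof -
  interpret shift_group \<Lambda> N by fact
  note cl = lattice_closed[OF L] lattice_minus[OF L] and add = additive_on_lattice[OF L l]
  define E where "E = {g \<in> coset c \<Lambda>. 0 \<le> l (g - c) \<and> l (g - c) < r}"
  define \<Lambda>' where "\<Lambda>' = {a \<in> \<Lambda>. l a = 0}"
  have ker': "free_lattice d \<Lambda>'" using ker by (simp add: \<Lambda>'_def)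
  define M where "M = values_in N (coset c \<Lambda>) K"
  have M: "shift_group \<Lambda> M"
    unfolding M_def by (intro shift_group_values_in N K) (rule coset_add[OF L])
  interpret M: shift_group \<Lambda> M by (rule M)
  have in_M: "n \<in> M" if "n \<in> N" "\<forall>g\<in>E. n g \<in> K" for n
    using det[OF that(1)] that unfolding M_def values_in_def E_def by blast
  have l_shift: "l (g + a - c) = l (g - c)" if "g \<in> coset c \<Lambda>" "a \<in> \<Lambda>'" for g a
  proof -
    have "g - c \<in> \<Lambda>" "a \<in> \<Lambda>" "l a = 0" using that by (auto simp: coset_def \<Lambda>'_def)
    then show ?thesis using add(1)[of "g - c" a] by (simp add: algebra_simps)
  qed
  have E_add: "g + a \<in> E" if "a \<in> \<Lambda>'" "g \<in> E" for g a
    using that l_shift coset_add[OF L] by (auto simp: E_def \<Lambda>'_def)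
  have E_shift: "g + a \<in> E \<longleftrightarrow> g \<in> E" if "a \<in> \<Lambda>'" for g a
    using E_add[OF that] E_add[OF lattice_minus(1)[OF ker' that], of "g + a"]
    by auto
  define D where "D = (\<lambda>j. c + of_int j * v) ` {0..<r}"
  have D: "c + of_int (l (g - c)) * v \<in> D" "g - (c + of_int (l (g - c)) * v) \<in> \<Lambda>'" if "g \<in> E" for g
  proof -
    have g: "g - c \<in> \<Lambda>" "l (g - c) \<in> {0..<r}" using that by (auto simp: E_def coset_def)
    then show "c + of_int (l (g - c)) * v \<in> D" by (auto simp: D_def)
    have "g - c - of_int (l (g - c)) * v \<in> \<Lambda>" by (rule cl(5)[OF cl(3)[OF v(1)] g(1)])
    moreover have "l (g - c - of_int (l (g - c)) * v) = 0"
      using add(4)[OF cl(3)[OF v(1)] g(1)] add(5)[OF v(1)] v(2) by simp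
    moreover have "g - c - of_int (l (g - c)) * v = g - (c + of_int (l (g - c)) * v)" by simp
    ultimately show "g - (c + of_int (l (g - c)) * v) \<in> \<Lambda>'" unfolding \<Lambda>'_def by simp
  qed
  have \<Lambda>'_sub: "\<Lambda>' \<subseteq> \<Lambda>" by (auto simp: \<Lambda>'_def)
  let ?R = "restrict_to E :: ('g \<Rightarrow> 's) \<Rightarrow> _"

  \<comment> \<open>Periodicity inside the strip comes from the lower-rank lattice.\<close>
  have "\<exists>m'\<in>?R ` N. \<exists>k'>0. (\<forall>w\<in>V. m' w = 0) \<and> periodic_mod \<Lambda>' k' {0} (?R x + m')"
  proof (rule IH[unfolded periodic_approximation_def, rule_format])
    show "shift_group \<Lambda>' (?R ` N)"
      using N \<Lambda>'_sub E_shift by (rule shift_group_restrict_to)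
    show "supported_on \<Lambda>' D (?R ` N)"
      unfolding supported_on_def
    proof (intro ballI allI impI)
      fix n g assume "n \<in> ?R ` N" "n g \<noteq> 0"
      then have "g \<in> E" by (auto simp: restrict_to_def split: if_splits)
      then show "\<exists>c\<in>D. g \<in> coset c \<Lambda>'" using D unfolding coset_def by blast
    qed
    show "periodic_mod \<Lambda>' k (?R ` N) (?R x)"
      unfolding periodic_mod_def
    proof
      fix a assume a: "a \<in> \<Lambda>'"
      have "- ?R x + translate (of_int k * a) (?R x) = ?R (- x + translate (of_int k * a) x)"
        using translate_restrict_to[OF E_shift[OF lattice_closed(3)[OF ker' a]], where x = x]
        by (simp add: restrict_to_add)
      moreover have "- x + translate (of_int k * a) x \<in> N"
        using x(1) a \<Lambda>'_sub unfolding periodic_mod_def by blast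
      ultimately show "- ?R x + translate (of_int k * a) (?R x) \<in> ?R ` N" by simp
    qed
  qed (use ker' x(2) V in \<open>auto simp: D_def\<close>)
  then obtain m k0 where m: "m \<in> N" "\<forall>w\<in>V. ?R m w = 0" and k0: "k0 > 0"
    and per: "periodic_mod \<Lambda>' k0 {0} (?R x + ?R m)" by blast
  define z where "z = x + m"
  have Rz: "periodic_mod \<Lambda>' k0 {0} (?R z)"
    using per by (simp add: z_def restrict_to_add)
  have zN: "periodic_mod \<Lambda> k N z"
    unfolding z_def by (rule periodic_mod_add[OF L N x(1) m(1)])
  define k1 where "k1 = k * k0"
  have k1: "k1 > 0" using x(2) k0 by (simp add: k1_def)
  have zM: "- z + translate (of_int k1 * a) z \<in> M" if a: "a \<in> \<Lambda>'" for a
  proof (rule in_M)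
    show "- z + translate (of_int k1 * a) z \<in> N"
      using periodic_mod_mult[OF L zN, of k0] a \<Lambda>'_sub unfolding periodic_mod_def k1_def by blast
    show "\<forall>g\<in>E. (- z + translate (of_int k1 * a) z) g \<in> K"
    proof
      fix g assume g: "g \<in> E"
      have ka: "of_int k1 * a \<in> \<Lambda>'" "of_int k * a \<in> \<Lambda>'"
        using lattice_closed(3)[OF ker' a] by blast+
      have "?R z (g + of_int k0 * (of_int k * a)) = ?R z g"
        by (rule periodic_mod_zeroD[OF Rz ka(2)])
      moreover have "of_int k0 * (of_int k * a) = of_int k1 * a" by (simp add: k1_def)
      ultimately have "z (g + of_int k1 * a) = z g"
        using g E_add[OF ka(1) g] by (simp add: restrict_to_def)
      then show "(- z + translate (of_int k1 * a) z) g \<in> K"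
        using add_subgroupD(1)[OF K] by simp
    qed
  qed

  \<comment> \<open>In the transverse direction the translates of \<open>z\<close> fall into finitely many classes.\<close>
  define u where "u = of_int k * v"
  have u: "u \<in> \<Lambda>" unfolding u_def by (rule cl(3)[OF v(1)])
  define zs where "zs i = translate (of_int (int i) * u) z" for i
  have iu: "of_int i * u \<in> \<Lambda>" for i by (rule cl(3)[OF u])
  have zs_N: "- z + zs i \<in> N" for i
  proof -
    have "of_int (int i) * u = of_int k * (of_int (int i) * v)" by (simp add: u_def)
    then show ?thesis
      using zN cl(3)[OF v(1), of "int i"] unfolding periodic_mod_def zs_def by simp
  qed
  obtain R where R: "finite R" "R \<subseteq> \<Lambda>'" "\<forall>a\<in>\<Lambda>'. \<exists>r\<in>R. \<exists>b\<in>\<Lambda>'. a = r + of_int k1 * b"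
    using lattice_finite_index[OF ker' k1] .
  \<comment> \<open>Representatives of the strip modulo \<open>k1 * \<Lambda>'\<close>.\<close>
  define T where "T = (\<lambda>(c, r). c + r) ` (D \<times> R)"
  have "finite T" unfolding T_def D_def using R(1) by simp
  let ?f = "\<lambda>i. restrict (zs i) T"
  have "?f i \<in> (\<Pi>\<^sub>E g\<in>T. (\<lambda>n. z g + n g) ` N)" for i
  proof (rule restrict_PiE_iff[THEN iffD2], rule ballI)
    fix g
    have "zs i g = z g + (- z + zs i) g" by (simp add: add.assoc[symmetric])
    then show "zs i g \<in> (\<lambda>n. z g + n g) ` N" using zs_N[of i] by blast
  qed
  moreover have "finite (\<Pi>\<^sub>E g\<in>T. (\<lambda>n. z g + n g) ` N)"
  proof (rule finite_PiE[OF \<open>finite T\<close>])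
    fix g
    have "(\<lambda>n. z g + n g) ` N = (\<lambda>s. z g + s) ` (\<lambda>n. n g) ` N" by (auto simp: image_image)
    then show "finite ((\<lambda>n. z g + n g) ` N)"
      using finite_values_compact[OF compact, of g] by simp
  qed
  ultimately have "finite (range ?f)"
    by (meson finite_subset image_subsetI)
  then have "\<not> inj ?f"
    using finite_imageD infinite_UNIV_nat by blast
  then obtain i j where ij: "i < j" "?f i = ?f j"
    unfolding inj_def by (metis linorder_neqE_nat)
  have diff_M: "- zs i + zs j \<in> M"
  proof (rule in_M)
    show "- zs i + zs j \<in> N"
      using left_cong_trans[OF subgroup left_cong_sym[OF subgroup zs_N] zs_N] .
    show "\<forall>g\<in>E. (- zs i + zs j) g \<in> K"
    proof
      fix g assume g: "g \<in> E"
      define c' where "c' = c + of_int (l (g - c)) * v"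
      have c': "c' \<in> D" "g - c' \<in> \<Lambda>'" using D[OF g] by (auto simp: c'_def)
      obtain r b where rb: "r \<in> R" "b \<in> \<Lambda>'" "g - c' = r + of_int k1 * b"
        using bspec[OF R(3) c'(2)] by blast
      define g0 where "g0 = c' + r"
      have "g0 \<in> T" using c'(1) rb(1) by (auto simp: T_def g0_def)
      then have same: "zs i g0 = zs j g0" using fun_cong[OF ij(2), of g0] by simp
      have g_eq: "g = g0 + of_int k1 * b" using rb(3) by (simp add: g0_def algebra_simps)
      have "g0 = g + - (of_int k1 * b)" using g_eq by simp
      moreover have "- (of_int k1 * b) \<in> \<Lambda>"
        using cl(4)[OF cl(3)] rb(2) \<Lambda>'_sub by blast
      moreover have gQ: "g \<in> coset c \<Lambda>" using g by (auto simp: E_def)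
      ultimately have g0Q: "g0 \<in> coset c \<Lambda>" using coset_add[OF L] by metis
      have move: "- zs i' g0 + zs i' g \<in> K" for i'
      proof -
        have "g0 + of_int (int i') * u \<in> coset c \<Lambda>" by (rule coset_add[OF L g0Q iu])
        then have "(- z + translate (of_int k1 * b) z) (g0 + of_int (int i') * u) \<in> K"
          using zM[OF rb(2)] by (auto simp: M_def values_in_def)
        then show ?thesis by (simp add: zs_def g_eq ac_simps)
      qed
      have "- zs i g + zs j g0 \<in> K"
        using left_cong_sym[OF K move[of i]] same by simp
      then have "- zs i g + zs j g \<in> K"
        using left_cong_trans[OF K _ move[of j]] by blast
      then show "(- zs i + zs j) g \<in> K" by simp
    qed
  qed
  define p where "p = int j - int i"
  have p: "p > 0" using ij(1) by (simp add: p_def)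
  have zp: "- z + translate (of_int p * u) z \<in> M"
  proof -
    have "translate (of_int (- int i) * u) (- zs i + zs j) \<in> M"
      by (rule M.translate[OF iu diff_M])
    moreover have "translate (of_int (- int i) * u) (zs i) = z"
      by (simp add: zs_def translate_translate)
    moreover have "translate (of_int (- int i) * u) (zs j) = translate (of_int p * u) z"
      by (simp add: zs_def translate_translate p_def algebra_simps)
    ultimately show ?thesis by (simp only: translate_add)
  qed
  \<comment> \<open>For \<open>a = b + l a * v\<close> with \<open>b\<close> in \<open>\<Lambda>'\<close>, the translation by \<open>k' * a\<close> is composed of one by a multiple
    of \<open>k1 * b\<close> and one by a multiple of \<open>p * u\<close>; both preserve \<open>z + M\<close>.\<close>
  define k' where "k' = k1 * (p * k)"
  have "periodic_mod \<Lambda> k' M z"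
    unfolding periodic_mod_def
  proof
    fix a assume a: "a \<in> \<Lambda>"
    define b where "b = a - of_int (l a) * v"
    have b: "b \<in> \<Lambda>'"
      unfolding \<Lambda>'_def b_def using cl(5)[OF cl(3)[OF v(1)] a] add(4)[OF cl(3)[OF v(1)] a] add(5)[OF v(1)] v(2)
      by simp
    define b1 where "b1 = of_int k1 * (of_int (p * k) * b)"
    have b1: "b1 \<in> \<Lambda>" "- z + translate b1 z \<in> M"
      using zM[OF lattice_closed(3)[OF ker' b]] lattice_closed(3)[OF ker' lattice_closed(3)[OF ker' b]] \<Lambda>'_sub
      unfolding b1_def by blast+
    have b2: "- z + translate (of_int (k1 * l a) * (of_int p * u)) z \<in> M"
      by (rule stabilizer_closed(2)[OF L M iu zp])
    have "- z + translate (b1 + of_int (k1 * l a) * (of_int p * u)) z \<in> M"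
      by (rule stabilizer_closed(1)[OF L M b1 cl(3)[OF iu] b2])
    moreover have "b1 + of_int (k1 * l a) * (of_int p * u) = of_int k' * a"
      by (simp add: b1_def b_def k'_def u_def algebra_simps)
    ultimately show "- z + translate (of_int k' * a) z \<in> M" by simp
  qed
  moreover have "k' > 0" using k1 p x(2) by (simp add: k'_def)
  moreover have "\<forall>g\<in>V \<inter> E. m g \<in> K"
    using m(2) add_subgroupD(1)[OF K] by (auto simp: restrict_to_def)
  ultimately show ?thesis
    using m(1) unfolding z_def M_def E_def by blast
qed

text \<open>In either case there is a set \<open>E\<close> of sites (the whole orbit, or a strip) that determines the
  orbit modulo \<open>K\<close> and such that \<open>x\<close> can be made periodic modulo the smaller group by a correction
  trivial modulo \<open>K\<close> on a prescribed finite part of \<open>E\<close>. If this part is chosen large enough, the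
  correction agrees on \<open>W\<close> with a member of the smaller group, and subtracting the latter
  makes it vanish on \<open>W\<close>.\<close>
lemma periodic_descent:
  fixes N :: "('g::comm_ring_1 \<Rightarrow> 's::group_add) set"
  assumes IH: "periodic_approximation d TYPE('g \<Rightarrow> 's)"
    and L: "free_lattice (Suc d) \<Lambda>" and N: "shift_group \<Lambda> N"
    and x: "periodic_mod \<Lambda> k N x" "k > 0" and W: "finite W" and nontrivial: "(\<lambda>n. n c) ` N \<noteq> {0}"
  shows "\<exists>K. add_subgroup K \<and> K \<subset> (\<lambda>n. n c) ` N \<and> (\<exists>m\<in>N. \<exists>k'>0. (\<forall>w\<in>W. m w = 0) \<and>
    periodic_mod \<Lambda> k' (values_in N (coset c \<Lambda>) K) (x + m))"
proof -
  interpret shift_group \<Lambda> N by fact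
  define G where "G = (\<lambda>n. n c) ` N"
  have G: "add_subgroup G" "finite G" "G \<noteq> {0}"
    unfolding G_def using values_subgroup[OF subgroup] finite_values_compact[OF compact] nontrivial by auto
  obtain K where K: "normal_subgroup K G" "K \<noteq> G"
    and maximal: "\<And>A. normal_subgroup A G \<Longrightarrow> K \<subseteq> A \<Longrightarrow> A = K \<or> A = G"
    using ex_maximal_normal_subgroup[OF G] by metis
  have Ksub: "add_subgroup K" "K \<subset> G" using K by (auto simp: normal_subgroup_def)
  define M where "M = values_in N (coset c \<Lambda>) K"
  have M: "shift_group \<Lambda> M"
    unfolding M_def by (intro shift_group_values_in N Ksub) (rule coset_add[OF L])
  interpret M: shift_group \<Lambda> M by (rule M)
  have "\<exists>E. (\<forall>n\<in>N. (\<forall>g\<in>E. n g \<in> K) \<longrightarrow> (\<forall>g\<in>coset c \<Lambda>. n g \<in> K)) \<and>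
    (\<forall>V. finite V \<longrightarrow> V \<subseteq> E \<longrightarrow> (\<exists>m\<in>N. \<exists>k'>0. (\<forall>g\<in>V. m g \<in> K) \<and> periodic_mod \<Lambda> k' M (x + m)))"
  proof (cases "\<forall>F. finite F \<longrightarrow> F \<subseteq> coset c \<Lambda> \<longrightarrow> realises_all N K G F")
    case True
    then have "\<exists>m\<in>N. \<exists>k'>0. (\<forall>g\<in>V. m g \<in> K) \<and> periodic_mod \<Lambda> k' M (x + m)"
      if "finite V" "V \<subseteq> coset c \<Lambda>" for V
      unfolding M_def G_def by (intro periodic_descent_free[OF L N Ksub(1) _ x that]) blast
    then show ?thesis by (intro exI[of _ "coset c \<Lambda>"]) blast
  next
    case False
    let ?bad = "\<lambda>F. finite F \<and> F \<subseteq> coset c \<Lambda> \<and> \<not> realises_all N K G F"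
    from False obtain F where "?bad F" by blast
    then obtain P where P: "?bad P" and least: "\<And>F. ?bad F \<Longrightarrow> card P \<le> card F"
      using ex_has_least_nat[of ?bad F card] by blast
    have good: "realises_all N K G (P - {w})" if "w \<in> P" for w
    proof (rule ccontr)
      assume "\<not> ?thesis"
      then have "card P \<le> card (P - {w})" using P by (intro least) auto
      then show False using P that by (meson card_Diff1_less not_le)
    qed
    have "P \<noteq> {}"
      using P add_subgroupD(1)[OF subgroup] by (auto simp: realises_all_def)
    have det: "n w \<in> K" if "w \<in> P" "n \<in> N" "\<forall>v\<in>P - {w}. n v \<in> K" for w n
    proof (rule minimal_unrealised_determines[OF subgroup G(1) K(1) maximal _ _ that(1) good])
      show "(\<lambda>n. n g) ` N = G" if "g \<in> P" for g
        unfolding G_def using P that by (intro values_coset[OF L N]) blast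
    qed (use P that in auto)
    have "finite ((\<lambda>w. w - c) ` P)" "(\<lambda>w. w - c) ` P \<subseteq> \<Lambda>"
      using P by (auto simp: coset_def)
    then obtain l v where v: "v \<in> \<Lambda>" "l v = (1::int)" and l: "additive_on \<Lambda> l"
      and inj: "inj_on l ((\<lambda>w. w - c) ` P)" and ker: "free_lattice d {a \<in> \<Lambda>. l a = 0}"
      by (rule lattice_height[OF L])
    have Pc: "finite P" "P \<subseteq> coset c \<Lambda>" using P by simp_all
    have injP: "inj_on (\<lambda>w. l (w - c)) P"
      using comp_inj_on[OF _ inj] by (simp add: inj_on_def comp_def)
    obtain r where r: "\<forall>n\<in>N. (\<forall>g\<in>{g \<in> coset c \<Lambda>. 0 \<le> l (g - c) \<and> l (g - c) < r}. n g \<in> K)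
      \<longrightarrow> (\<forall>g\<in>coset c \<Lambda>. n g \<in> K)"
      by (rule strip_determines[OF L N l Pc(1) \<open>P \<noteq> {}\<close> Pc(2) injP, where K = K]) (rule det; assumption)
    let ?E = "{g \<in> coset c \<Lambda>. 0 \<le> l (g - c) \<and> l (g - c) < r}"
    have "\<exists>m\<in>N. \<exists>k'>0. (\<forall>g\<in>V. m g \<in> K) \<and> periodic_mod \<Lambda> k' M (x + m)"
      if V: "finite V" "V \<subseteq> ?E" for V
    proof -
      have "\<exists>m\<in>N. \<exists>k'>0. (\<forall>g\<in>V \<inter> ?E. m g \<in> K) \<and> periodic_mod \<Lambda> k' M (x + m)"
        unfolding M_def
        by (rule periodic_descent_strip[OF IH L N Ksub(1) l v ker _ x V(1)]) (use r in blast)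
      moreover have "V \<inter> ?E = V" using V(2) by (rule Int_absorb2)
      ultimately show ?thesis by simp
    qed
    with r show ?thesis by (intro exI[of _ ?E]) blast
  qed
  then obtain E where det: "\<forall>n\<in>N. (\<forall>g\<in>E. n g \<in> K) \<longrightarrow> (\<forall>g\<in>coset c \<Lambda>. n g \<in> K)"
    and approx: "\<forall>V. finite V \<longrightarrow> V \<subseteq> E \<longrightarrow>
      (\<exists>m\<in>N. \<exists>k'>0. (\<forall>g\<in>V. m g \<in> K) \<and> periodic_mod \<Lambda> k' M (x + m))"
    by (elim exE conjE)
  obtain V where V: "finite V" "V \<subseteq> E"
    and local: "\<forall>m\<in>N. (\<forall>g\<in>V. m g \<in> K) \<longrightarrow> (\<exists>n\<in>M. \<forall>w\<in>W. n w = m w)"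
    unfolding M_def by (rule values_in_local[OF N Ksub(1) W, of E "coset c \<Lambda>"]) (rule det[THEN bspec, THEN mp]; assumption)
  obtain m k' where m: "m \<in> N" "k' > 0" "\<forall>g\<in>V. m g \<in> K" "periodic_mod \<Lambda> k' M (x + m)"
    using approx[rule_format, OF V] by blast
  obtain n where n: "n \<in> M" "\<forall>w\<in>W. n w = m w" using local m(1,3) by blast
  have "n \<in> N" using n(1) by (simp add: M_def values_in_def)
  have "periodic_mod \<Lambda> k' M (x + m + - n)"
    by (rule periodic_mod_add[OF L M m(4) add_subgroupD(3)[OF M.subgroup n(1)]])
  then have "periodic_mod \<Lambda> k' M (x + (m - n))"
    by (simp add: add_diff_eq)
  moreover have "m - n \<in> N" by (rule add_subgroupD(4)[OF subgroup m(1) \<open>n \<in> N\<close>])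
  moreover have "\<forall>w\<in>W. (m - n) w = 0" using n(2) by simp
  ultimately show ?thesis using Ksub m(2) unfolding M_def G_def by blast
qed

text \<open>The inner induction is on the sum, over the representatives \<open>c\<close> of the orbits, of
  the orders of the groups of values at \<open>c\<close>. If all these groups are trivial, then \<open>N = {0}\<close>.\<close>
theorem periodic_approximation_every_rank:
  "periodic_approximation d TYPE('g::comm_ring_1 \<Rightarrow> 's::group_add)"
proof (induction d)
  case 0
  show ?case
    unfolding periodic_approximation_def
  proof (intro allI impI)
    fix \<Lambda> :: "'g set" and N :: "('g \<Rightarrow> 's) set" and x :: "'g \<Rightarrow> 's" and W :: "'g set"
    assume "free_lattice 0 \<Lambda>" and N: "shift_group \<Lambda> N"
    then have "\<Lambda> = {0}" by (auto elim: free_lattice.cases)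
    then have "periodic_mod \<Lambda> 1 {0} (x + 0)" by (simp add: periodic_mod_def)
    moreover have "0 \<in> N" using add_subgroupD(1)[OF shift_group.subgroup[OF N]] .
    ultimately show "\<exists>m\<in>N. \<exists>k'>0. (\<forall>w\<in>W. m w = 0) \<and> periodic_mod \<Lambda> k' {0} (x + m)"
      by (intro bexI[of _ 0] exI[of _ 1]) auto
  qed
next
  case (Suc d)
  show ?case
    unfolding periodic_approximation_def
  proof (intro allI impI)
    fix \<Lambda> :: "'g set" and N :: "('g \<Rightarrow> 's) set" and D W :: "'g set" and x :: "'g \<Rightarrow> 's" and k :: int
    assume L: "free_lattice (Suc d) \<Lambda>" and "shift_group \<Lambda> N" and D: "finite D" and "supported_on \<Lambda> D N"
      and "periodic_mod \<Lambda> k N x" and "k > 0" and W: "finite W"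
    then show "\<exists>m\<in>N. \<exists>k'>0. (\<forall>w\<in>W. m w = 0) \<and> periodic_mod \<Lambda> k' {0} (x + m)"
    proof (induction "\<Sum>c\<in>D. card ((\<lambda>n. n c) ` N)" arbitrary: N x k rule: less_induct)
      case (less N x k)
      note N = less.prems(2) and supp = less.prems(4) and x = less.prems(5,6)
      interpret shift_group \<Lambda> N by fact
      show ?case
      proof (cases "\<forall>c\<in>D. (\<lambda>n. n c) ` N = {0}")
        case True
        have "n g = 0" if n: "n \<in> N" for n g
        proof (rule ccontr)
          assume "n g \<noteq> 0"
          then obtain c where c: "c \<in> D" "g \<in> coset c \<Lambda>"
            using supp n unfolding supported_on_def by blast
          then have "(\<lambda>n. n g) ` N = {0}"
            using values_coset[OF L N c(2)] True c(1) by simp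
          then show False using n \<open>n g \<noteq> 0\<close> by blast
        qed
        then have "N = {0}" using add_subgroupD(1)[OF subgroup] by (auto simp: fun_eq_iff)
        then show ?thesis using x by (intro bexI[of _ 0] exI[of _ k]) auto
      next
        case False
        then obtain c where c: "c \<in> D" "(\<lambda>n. n c) ` N \<noteq> {0}" by blast
        from periodic_descent[OF Suc L N x W c(2)] obtain K m k' where K: "add_subgroup K" "K \<subset> (\<lambda>n. n c) ` N" and m: "m \<in> N" "k' > 0" "\<forall>w\<in>W. m w = 0"
          and per: "periodic_mod \<Lambda> k' (values_in N (coset c \<Lambda>) K) (x + m)"
          by (elim exE conjE bexE)
        define M where "M = values_in N (coset c \<Lambda>) K"
        have M: "shift_group \<Lambda> M"
          unfolding M_def by (intro shift_group_values_in N K) (rule coset_add[OF L])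
        have "M \<subseteq> N" by (auto simp: M_def values_in_def)
        have fin: "finite ((\<lambda>n. n b) ` N)" for b by (rule finite_values_compact[OF compact])
        have "c \<in> coset c \<Lambda>" using lattice_closed(1)[OF L] by (simp add: coset_def)
        then have "(\<lambda>n. n c) ` M \<subseteq> K" by (auto simp: M_def values_in_def)
        then have "card ((\<lambda>n. n c) ` M) < card ((\<lambda>n. n c) ` N)"
          using K(2) fin by (intro psubset_card_mono) auto
        moreover have "card ((\<lambda>n. n b) ` M) \<le> card ((\<lambda>n. n b) ` N)" for b
          using \<open>M \<subseteq> N\<close> fin by (intro card_mono) auto
        ultimately have "(\<Sum>c\<in>D. card ((\<lambda>n. n c) ` M)) < (\<Sum>c\<in>D. card ((\<lambda>n. n c) ` N))"
          using D c(1) by (intro sum_strict_mono_ex1) auto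
        moreover have "supported_on \<Lambda> D M"
          using supp \<open>M \<subseteq> N\<close> by (auto simp: supported_on_def)
        ultimately have "\<exists>n\<in>M. \<exists>k'>0. (\<forall>w\<in>W. n w = 0) \<and> periodic_mod \<Lambda> k' {0} (x + m + n)"
          using less.hyps[OF _ L M D _ per[folded M_def] m(2) W] by simp
        then obtain n k'' where n: "n \<in> M" "k'' > 0" "\<forall>w\<in>W. n w = 0" "periodic_mod \<Lambda> k'' {0} (x + m + n)"
          by blast
        have "m + n \<in> N" using add_subgroupD(2)[OF subgroup m(1)] n(1) \<open>M \<subseteq> N\<close> by blast
        moreover have "periodic_mod \<Lambda> k'' {0} (x + (m + n))" using n(4) by (simp only: add.assoc)
        moreover have "\<forall>w\<in>W. (m + n) w = 0" using m(3) n(3) by simp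
        ultimately show ?thesis using n(2) by blast
      qed
    qed
  qed
qed

corollary periodic_approximationD:
  assumes "free_lattice d \<Lambda>" "shift_group \<Lambda> N" "finite D" "supported_on \<Lambda> D N"
    "periodic_mod \<Lambda> k N x" "k > 0" "finite W"
  shows "\<exists>m\<in>N. \<exists>k'>0. (\<forall>w\<in>W. m w = 0) \<and> periodic_mod \<Lambda> k' {0} (x + m)"
  by (rule periodic_approximation_every_rank[unfolded periodic_approximation_def, rule_format, OF assms])

section \<open>The regular representation\<close>

text \<open>The bijections of a type form a group in the sense of the type class \<open>group_add\<close>. By
  Cayley's theorem this accommodates every group given by a carrier set, so that the density
  theorem, stated for values in a type of this class, applies to shifts over such groups.\<close>
typedef 'a symmetry = "{f :: 'a \<Rightarrow> 'a. bij f}"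
  morphisms apply_symmetry Symmetry
  by (rule exI[of _ id]) simp

setup_lifting type_definition_symmetry

instantiation symmetry :: (type) group_add
begin

lift_definition zero_symmetry :: "'a symmetry" is id by simp
lift_definition plus_symmetry :: "'a symmetry \<Rightarrow> 'a symmetry \<Rightarrow> 'a symmetry" is "(\<circ>)" by (rule bij_comp)
lift_definition uminus_symmetry :: "'a symmetry \<Rightarrow> 'a symmetry" is "inv_into UNIV" by (rule bij_imp_bij_inv)
definition minus_symmetry :: "'a symmetry \<Rightarrow> 'a symmetry \<Rightarrow> 'a symmetry" where
  "minus_symmetry f g = f + - g"

instance
proof
  fix f g h :: "'a symmetry"
  show "f + g + h = f + (g + h)" by transfer (simp add: comp_assoc)
  show "0 + f = f" "f + 0 = f" by (transfer; simp)+
  show "- f + f = 0" by transfer (simp add: bij_is_inj)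
  show "f + - g = f - g" by (simp add: minus_symmetry_def)
qed

end

definition cayley :: "('s, 'b) monoid_scheme \<Rightarrow> 's \<Rightarrow> 's symmetry" where
  "cayley S s = Symmetry (\<lambda>t. if t \<in> carrier S then s \<otimes>\<^bsub>S\<^esub> t else t)"

lemma (in group) apply_cayley:
  assumes "s \<in> carrier G"
  shows "apply_symmetry (cayley G s) = (\<lambda>t. if t \<in> carrier G then s \<otimes> t else t)"
proof -
  have "bij (\<lambda>t. if t \<in> carrier G then s \<otimes> t else t)"
    by (rule o_bij[of "\<lambda>t. if t \<in> carrier G then inv s \<otimes> t else t"])
       (use assms in \<open>auto simp: fun_eq_iff m_assoc[symmetric]\<close>)
  then show ?thesis by (simp add: cayley_def Symmetry_inverse)
qed

lemma (in group) cayley_hom: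
  shows "s \<in> carrier G \<Longrightarrow> t \<in> carrier G \<Longrightarrow> cayley G (s \<otimes> t) = cayley G s + cayley G t"
    and "cayley G \<one> = 0"
    and "s \<in> carrier G \<Longrightarrow> cayley G (inv s) = - cayley G s"
    and "inj_on (cayley G) (carrier G)"
proof -
  show add: "cayley G (s \<otimes> t) = cayley G s + cayley G t" if "s \<in> carrier G" "t \<in> carrier G" for s t
  proof (rule apply_symmetry_inject[THEN iffD1])
    show "apply_symmetry (cayley G (s \<otimes> t)) = apply_symmetry (cayley G s + cayley G t)"
      using that by (auto simp: plus_symmetry.rep_eq apply_cayley fun_eq_iff m_assoc)
  qed
  show zero: "cayley G \<one> = 0"
    by (rule apply_symmetry_inject[THEN iffD1]) (auto simp: zero_symmetry.rep_eq apply_cayley fun_eq_iff)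
  show "cayley G (inv s) = - cayley G s" if "s \<in> carrier G"
    using add[of "inv s" s] that zero by (simp add: eq_neg_iff_add_eq_0)
  show "inj_on (cayley G) (carrier G)"
  proof (rule inj_onI)
    fix s t assume st: "s \<in> carrier G" "t \<in> carrier G" and "cayley G s = cayley G t"
    then have "apply_symmetry (cayley G s) \<one> = apply_symmetry (cayley G t) \<one>" by simp
    then show "s = t" using st by (simp add: apply_cayley)
  qed
qed

section \<open>Periodic points of group shifts\<close>

definition zero_beyond :: "nat \<Rightarrow> (nat \<Rightarrow> int) set" where
  "zero_beyond d = {g. \<forall>i\<ge>d. g i = 0}"

lemma of_int_fun_apply: "(of_int k :: nat \<Rightarrow> int) i = k"
  by (induction k rule: int_induct[where k = 0]) simp_all

lemma free_lattice_zero_beyond: "free_lattice d (zero_beyond d)"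
proof (induction d)
  case 0
  have "zero_beyond 0 = {0}" by (auto simp: zero_beyond_def fun_eq_iff)
  then show ?case using lattice_0 by simp
next
  case (Suc d)
  let ?e = "(\<lambda>i. of_bool (i = d)) :: nat \<Rightarrow> int"
  show ?case
  proof (rule lattice_SucI[OF Suc, of ?e])
    show "k = 0" if "of_int k * ?e \<in> zero_beyond d" for k :: int
    proof -
      have "(of_int k * ?e) d = 0" using that unfolding zero_beyond_def by blast
      then show ?thesis by (simp add: of_int_fun_apply)
    qed
    show "a \<in> zero_beyond (Suc d) \<longleftrightarrow> (\<exists>k::int. a - of_int k * ?e \<in> zero_beyond d)" for a
    proof
      assume a: "a \<in> zero_beyond (Suc d)"
      show "\<exists>k::int. a - of_int k * ?e \<in> zero_beyond d"
        using a by (intro exI[of _ "a d"]) (auto simp: zero_beyond_def of_int_fun_apply le_Suc_eq Suc_le_eq)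
    next
      assume "\<exists>k::int. a - of_int k * ?e \<in> zero_beyond d"
      then show "a \<in> zero_beyond (Suc d)"
        by (auto simp: zero_beyond_def of_int_fun_apply)
    qed
  qed
qed

lemma carrier_lattice_group: "carrier (lattice_group d) = (\<Pi>\<^sub>E i\<in>{..<d}. UNIV)"
  by (simp add: lattice_group_def integer_group_def)

lemma compactin_full_shift:
  assumes "finite (carrier S)" "closedin (full_shift_topology d S) X"
  shows "compactin (full_shift_topology d S) X"
proof -
  have "compact_space (full_shift_topology d S)"
    using assms(1) unfolding full_shift_topology_def
    by (simp add: compact_space_product_topology compact_space_discrete_topology)
  then show ?thesis using assms(2) by (rule closedin_compact_space)
qed

definition periodic_points :: "nat \<Rightarrow> ((nat \<Rightarrow> int) \<Rightarrow> 's) set \<Rightarrow> int \<Rightarrow> ((nat \<Rightarrow> int) \<Rightarrow> 's) set" where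
  "periodic_points d X k =
    {y \<in> X. \<forall>a\<in>carrier (lattice_group d). shift d (\<lambda>i\<in>{..<d}. k * a i) y = y}"

text \<open>Extending configurations by zero to all of \<open>nat \<Rightarrow> int\<close> (the map \<open>emb\<close>) and embedding
  \<open>S\<close> by its regular representation turns \<open>X\<close> into a compact shift-invariant subgroup supported
  on the single orbit \<open>zero_beyond d\<close>. The point \<open>x\<close> lies in \<open>X\<close>, so its coset
  is invariant under all translations.\<close>
lemma periodic_points_dense:
  fixes S :: "('s, 'b) monoid_scheme"
  assumes S: "group S" "finite (carrier S)" and X: "subgroup X (full_shift_group d S)"
    and closed: "closedin (full_shift_topology d S) X"
    and invariant: "\<forall>\<gamma>\<in>carrier (lattice_group d). shift d \<gamma> ` X \<subseteq> X"
    and x: "x \<in> X" and W: "finite W" "W \<subseteq> carrier (lattice_group d)"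
  obtains y k where "k > 0" and "y \<in> periodic_points d X k" and "\<forall>w\<in>W. y w = x w"
proof -
  interpret S: group S by fact
  let ?Z = "carrier (lattice_group d)" and ?\<Lambda> = "zero_beyond d"
  have carr: "y \<gamma> \<in> carrier S" if "y \<in> X" "\<gamma> \<in> ?Z" for y \<gamma>
    using subgroup.subset[OF X] that by (auto simp: full_shift_group_def)
  have ext: "y \<in> extensional ?Z" if "y \<in> X" for y
    using subgroup.subset[OF X] that by (auto simp: full_shift_group_def PiE_def)
  define crop where "crop g = restrict g {..<d}" for g :: "nat \<Rightarrow> int"
  define pad where "pad \<gamma> i = (if i < d then \<gamma> i else 0)" for \<gamma> :: "nat \<Rightarrow> int" and i
  have crop: "crop g \<in> ?Z" for g by (simp add: carrier_lattice_group crop_def)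
  have pad: "pad \<gamma> \<in> ?\<Lambda>" for \<gamma> by (simp add: zero_beyond_def pad_def)
  have crop_pad: "crop (pad \<gamma>) = \<gamma>" if "\<gamma> \<in> ?Z" for \<gamma>
    using that by (auto simp: crop_def pad_def carrier_lattice_group fun_eq_iff PiE_def extensional_def)
  define emb where "emb y g = (if g \<in> ?\<Lambda> then cayley S (y (crop g)) else 0)" for y :: "(nat \<Rightarrow> int) \<Rightarrow> 's" and g
  have emb_mult: "emb (y \<otimes>\<^bsub>full_shift_group d S\<^esub> z) = emb y + emb z" if "y \<in> X" "z \<in> X" for y z
    using that S.cayley_hom(1) carr crop
    by (auto simp: emb_def fun_eq_iff full_shift_group_def)
  have emb_one: "emb \<one>\<^bsub>full_shift_group d S\<^esub> = 0"
    using crop S.cayley_hom(2) by (auto simp: emb_def fun_eq_iff full_shift_group_def)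
  have emb_inv: "emb (inv\<^bsub>full_shift_group d S\<^esub> y) = - emb y" if "y \<in> X" for y
  proof -
    have "y \<in> (\<Pi>\<^sub>E i\<in>?Z. carrier S)" using carr ext that by (auto simp: PiE_def)
    then have "inv\<^bsub>full_shift_group d S\<^esub> y = (\<lambda>i\<in>?Z. inv\<^bsub>S\<^esub> (y i))"
      unfolding full_shift_group_def using S.group_axioms by (rule inv_product_group)
    then show ?thesis
      using that S.cayley_hom(3) carr crop by (auto simp: emb_def fun_eq_iff)
  qed
  have emb_shift: "translate a (emb y) = emb (shift d (crop (- a)) y)" if "a \<in> ?\<Lambda>" for a y
  proof
    fix g
    have "g + a \<in> ?\<Lambda> \<longleftrightarrow> g \<in> ?\<Lambda>" using that by (simp add: zero_beyond_def)
    moreover have "(\<lambda>i\<in>{..<d}. crop g i - crop (- a) i) = crop (g + a)"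
      by (auto simp: crop_def fun_eq_iff)
    ultimately show "translate a (emb y) g = emb (shift d (crop (- a)) y) g"
      using crop by (simp add: emb_def shift_def)
  qed
  have shift_X: "shift d (crop a) y \<in> X" if "y \<in> X" for a y
    using invariant crop that by blast
  have emb_cont: "continuous_map (full_shift_topology d S) cantor emb"
    unfolding continuous_map_componentwise_UNIV
  proof
    fix g
    show "continuous_map (full_shift_topology d S) (discrete_topology UNIV) (\<lambda>y. emb y g)"
    proof (cases "g \<in> ?\<Lambda>")
      case True
      have "continuous_map (full_shift_topology d S) (discrete_topology (carrier S)) (\<lambda>y. y (crop g))"
        unfolding full_shift_topology_def by (rule continuous_map_product_projection[OF crop])
      moreover have "continuous_map (discrete_topology (carrier S)) (discrete_topology UNIV) (cayley S)"
        by simp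
      ultimately have "continuous_map (full_shift_topology d S) (discrete_topology UNIV) (cayley S \<circ> (\<lambda>y. y (crop g)))"
        by (rule continuous_map_compose)
      then show ?thesis using True by (simp add: emb_def comp_def)
    qed (simp add: emb_def)
  qed
  have N: "shift_group ?\<Lambda> (emb ` X)"
  proof
    show "add_subgroup (emb ` X)"
      unfolding add_subgroup_def
    proof (intro conjI ballI)
      show "0 \<in> emb ` X"
        using imageI[OF subgroup.one_closed[OF X], of emb] emb_one by simp
      fix m assume "m \<in> emb ` X"
      then obtain y where y: "y \<in> X" "m = emb y" by blast
      show "- m \<in> emb ` X"
        using imageI[OF subgroup.m_inv_closed[OF X y(1)], of emb] emb_inv[OF y(1)] y(2) by simp
      fix n assume "n \<in> emb ` X"
      then obtain z where z: "z \<in> X" "n = emb z" by blast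
      show "m + n \<in> emb ` X"
        using imageI[OF subgroup.m_closed[OF X y(1) z(1)], of emb] emb_mult[OF y(1) z(1)] y(2) z(2) by simp
    qed
    show "translate a n \<in> emb ` X" if "a \<in> ?\<Lambda>" "n \<in> emb ` X" for a n
      using that emb_shift shift_X by auto
    show "compactin cantor (emb ` X)"
      by (rule image_compactin[OF compactin_full_shift[OF S(2) closed] emb_cont])
  qed
  interpret shift_group ?\<Lambda> "emb ` X" by (rule N)
  have "periodic_mod ?\<Lambda> 1 (emb ` X) (emb x)"
    unfolding periodic_mod_def
    using add_subgroupD(2,3)[OF subgroup] translate x by simp
  moreover have "supported_on ?\<Lambda> {0} (emb ` X)"
    by (auto simp: supported_on_def coset_def emb_def split: if_splits)
  ultimately have "\<exists>m\<in>emb ` X. \<exists>k>0. (\<forall>w\<in>pad ` W. m w = 0) \<and> periodic_mod ?\<Lambda> k {0} (emb x + m)"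
    using W(1) by (intro periodic_approximationD[OF free_lattice_zero_beyond N]) auto
  then obtain z k where z: "z \<in> X" and k: "k > 0" and zW: "\<forall>w\<in>W. emb z (pad w) = 0"
    and per: "periodic_mod ?\<Lambda> k {0} (emb x + emb z)"
    by blast
  define y where "y = x \<otimes>\<^bsub>full_shift_group d S\<^esub> z"
  have y: "y \<in> X" unfolding y_def by (rule subgroup.m_closed[OF X x z])
  have emb_y: "emb y = emb x + emb z" unfolding y_def by (rule emb_mult[OF x z])
  have eqI: "s = t" if "cayley S s = cayley S t" "s \<in> carrier S" "t \<in> carrier S" for s t
    using that by (rule inj_onD[OF S.cayley_hom(4)])
  have "y w = x w" if w: "w \<in> W" for w
  proof -
    have "w \<in> ?Z" using w W(2) by blast
    have "emb y (pad w) = emb x (pad w)" using zW w by (simp add: emb_y)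
    then have "cayley S (y w) = cayley S (x w)"
      using pad crop_pad[OF \<open>w \<in> ?Z\<close>] by (simp add: emb_def)
    then show ?thesis using carr[OF y \<open>w \<in> ?Z\<close>] carr[OF x \<open>w \<in> ?Z\<close>] by (rule eqI)
  qed
  moreover have "y \<in> periodic_points d X k"
    unfolding periodic_points_def
  proof (intro CollectI conjI ballI y)
    fix a assume a: "a \<in> ?Z"
    show "shift d (\<lambda>i\<in>{..<d}. k * a i) y = y"
    proof (rule extensionalityI[of _ ?Z])
      show "shift d (\<lambda>i\<in>{..<d}. k * a i) y \<in> extensional ?Z" by (simp add: shift_def)
      show "y \<in> extensional ?Z" by (rule ext[OF y])
      fix \<gamma> assume \<gamma>: "\<gamma> \<in> ?Z"
      define \<delta> where "\<delta> = (\<lambda>i\<in>{..<d}. \<gamma> i - (\<lambda>i\<in>{..<d}. k * a i) i)"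
      have \<delta>: "\<delta> = crop (pad \<gamma> + of_int k * - pad a)"
        by (auto simp: \<delta>_def crop_def pad_def fun_eq_iff of_int_fun_apply)
      have "- pad a \<in> ?\<Lambda>" by (simp add: zero_beyond_def pad_def)
      have "pad \<gamma> + of_int k * - pad a \<in> ?\<Lambda>"
        by (simp add: zero_beyond_def pad_def of_int_fun_apply)
      moreover have "emb y (pad \<gamma> + of_int k * - pad a) = emb y (pad \<gamma>)"
        using per \<open>- pad a \<in> ?\<Lambda>\<close> unfolding emb_y by (rule periodic_mod_zeroD)
      ultimately have "cayley S (y \<delta>) = cayley S (y \<gamma>)"
        using pad crop_pad[OF \<gamma>] by (simp add: emb_def \<delta>)
      moreover have "\<delta> \<in> ?Z" using crop by (simp add: \<delta>)
      ultimately have "y \<delta> = y \<gamma>" using carr y \<gamma> by (intro eqI) auto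
      then show "shift d (\<lambda>i\<in>{..<d}. k * a i) y \<gamma> = y \<gamma>"
        using \<gamma> by (simp add: shift_def \<delta>_def)
    qed
  qed
  ultimately show ?thesis using that k by blast
qed

section \<open>Group shifts as dynamical systems\<close>

lemma restrict_in_lattice_group: "(\<lambda>i\<in>{..<d}. g i) \<in> carrier (lattice_group d)"
  by (simp add: carrier_lattice_group)

lemma shift_shift: "shift d \<gamma> (shift d \<delta> x) = shift d (\<gamma> \<otimes>\<^bsub>lattice_group d\<^esub> \<delta>) x"
proof
  fix g
  have "(\<lambda>i\<in>{..<d}. (\<lambda>i\<in>{..<d}. g i - \<gamma> i) i - \<delta> i) = (\<lambda>i\<in>{..<d}. g i - (\<gamma> \<otimes>\<^bsub>lattice_group d\<^esub> \<delta>) i)"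
    by (auto simp: fun_eq_iff lattice_group_def integer_group_def)
  then show "shift d \<gamma> (shift d \<delta> x) g = shift d (\<gamma> \<otimes>\<^bsub>lattice_group d\<^esub> \<delta>) x g"
    using restrict_in_lattice_group[of "\<lambda>i. g i - \<gamma> i" d] by (simp add: shift_def)
qed

lemma shift_one:
  assumes "x \<in> extensional (carrier (lattice_group d))"
  shows "shift d \<one>\<^bsub>lattice_group d\<^esub> x = x"
proof
  fix \<gamma>
  show "shift d \<one>\<^bsub>lattice_group d\<^esub> x \<gamma> = x \<gamma>"
  proof (cases "\<gamma> \<in> carrier (lattice_group d)")
    case True
    then have "(\<lambda>i\<in>{..<d}. \<gamma> i - (\<lambda>i\<in>{..<d}. 0) i) = \<gamma>"
      by (auto simp: carrier_lattice_group fun_eq_iff PiE_def extensional_def)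
    then show ?thesis using True by (simp add: shift_def lattice_group_def integer_group_def)
  next
    case False
    then show ?thesis using assms by (simp add: shift_def extensional_def)
  qed
qed

text \<open>A periodic point is determined by its values on the box \<open>{0..<k}\<^sup>d\<close>.\<close>
lemma finite_periodic_points:
  assumes "finite (carrier S)" and X: "X \<subseteq> carrier (full_shift_group d S)" and "k > 0"
  shows "finite (periodic_points d X k)"
proof -
  let ?Z = "carrier (lattice_group d)"
  define B where "B = (\<Pi>\<^sub>E i\<in>{..<d}. {0..<k})"
  have B: "finite B" "B \<subseteq> ?Z" by (auto simp: B_def carrier_lattice_group intro!: finite_PiE)
  have XS: "y \<in> (\<Pi>\<^sub>E \<gamma>\<in>?Z. carrier S)" if "y \<in> periodic_points d X k" for y
    using that X by (auto simp: periodic_points_def full_shift_group_def)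
  have reduce: "y \<gamma> = y (\<lambda>i\<in>{..<d}. \<gamma> i mod k)" if y: "y \<in> periodic_points d X k" and \<gamma>: "\<gamma> \<in> ?Z" for y \<gamma>
  proof -
    have "shift d (\<lambda>i\<in>{..<d}. k * (\<lambda>i\<in>{..<d}. \<gamma> i div k) i) y = y"
      using y restrict_in_lattice_group[of "\<lambda>i. \<gamma> i div k" d] unfolding periodic_points_def by blast
    from fun_cong[OF this, of \<gamma>] \<gamma>
    have "y \<gamma> = y (\<lambda>i\<in>{..<d}. \<gamma> i - (\<lambda>i\<in>{..<d}. k * (\<lambda>i\<in>{..<d}. \<gamma> i div k) i) i)"
      by (simp add: shift_def)
    also have "(\<lambda>i\<in>{..<d}. \<gamma> i - (\<lambda>i\<in>{..<d}. k * (\<lambda>i\<in>{..<d}. \<gamma> i div k) i) i) = (\<lambda>i\<in>{..<d}. \<gamma> i mod k)"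
      by (auto simp: fun_eq_iff minus_mult_div_eq_mod)
    finally show ?thesis .
  qed
  have "inj_on (\<lambda>y. restrict y B) (periodic_points d X k)"
  proof (rule inj_onI)
    fix y z assume y: "y \<in> periodic_points d X k" and z: "z \<in> periodic_points d X k"
      and eq: "restrict y B = restrict z B"
    show "y = z"
    proof (rule extensionalityI[of _ ?Z])
      show "y \<in> extensional ?Z" "z \<in> extensional ?Z" using XS[OF y] XS[OF z] by (auto simp: PiE_def)
      fix \<gamma> assume \<gamma>: "\<gamma> \<in> ?Z"
      have "(\<lambda>i\<in>{..<d}. \<gamma> i mod k) \<in> B" using \<open>k > 0\<close> by (simp add: B_def)
      then show "y \<gamma> = z \<gamma>"
        using reduce[OF y \<gamma>] reduce[OF z \<gamma>] fun_cong[OF eq, of "\<lambda>i\<in>{..<d}. \<gamma> i mod k"] by simp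
    qed
  qed
  moreover have "(\<lambda>y. restrict y B) ` periodic_points d X k \<subseteq> (\<Pi>\<^sub>E \<gamma>\<in>B. carrier S)"
    using XS B(2) by (fastforce simp: PiE_iff)
  moreover have "finite (\<Pi>\<^sub>E \<gamma>\<in>B. carrier S)" using B(1) assms(1) by (intro finite_PiE)
  ultimately show ?thesis by (meson finite_imageD finite_subset)
qed

text \<open>An equivariant injection permutes the finite set of points of period \<open>k\<close>, for each \<open>k\<close>. Its
  image is closed and contains all periodic points, which are dense.\<close>
lemma group_shift_surjunctive:
  fixes S :: "('s, 'b) monoid_scheme"
  assumes S: "group S" "finite (carrier S)" and X: "subgroup X (full_shift_group d S)"
    and closed: "closedin (full_shift_topology d S) X"
    and invariant: "\<forall>\<gamma>\<in>carrier (lattice_group d). shift d \<gamma> ` X \<subseteq> X"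
  shows "surjunctive (subtopology (full_shift_topology d S) X)
      (lattice_group d) (\<lambda>\<gamma>. restrict (shift d \<gamma>) X)"
  unfolding surjunctive_def
proof (intro allI impI, elim conjE)
  fix \<tau>
  let ?F = "full_shift_topology d S" and ?Z = "carrier (lattice_group d)"
  let ?T = "subtopology ?F X"
  have Xsub: "X \<subseteq> carrier (full_shift_group d S)" by (rule subgroup.subset[OF X])
  have "X \<subseteq> topspace ?F" by (rule closedin_subset[OF closed])
  then have top: "topspace ?T = X" by auto
  assume cont: "continuous_map ?T ?T \<tau>" and inj: "inj_on \<tau> (topspace ?T)"
    and equiv: "equivariant_map (lattice_group d) (\<lambda>\<gamma>. restrict (shift d \<gamma>) X) (topspace ?T) \<tau>"
  have \<tau>X: "\<tau> y \<in> X" if "y \<in> X" for y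
    using continuous_map_funspace[OF cont] that top by auto
  have per: "periodic_points d X k \<subseteq> \<tau> ` X" if "k > 0" for k
  proof -
    have "\<tau> y \<in> periodic_points d X k" if y: "y \<in> periodic_points d X k" for y
    proof -
      have yX: "y \<in> X" using y by (simp add: periodic_points_def)
      have "shift d (\<lambda>i\<in>{..<d}. k * a i) (\<tau> y) = \<tau> y" if "a \<in> ?Z" for a
      proof -
        let ?\<gamma> = "\<lambda>i\<in>{..<d}. k * a i"
        have "\<tau> (restrict (shift d ?\<gamma>) X y) = restrict (shift d ?\<gamma>) X (\<tau> y)"
          using equiv yX restrict_in_lattice_group[of "\<lambda>i. k * a i" d] unfolding equivariant_map_def top by blast
        moreover have "shift d ?\<gamma> y = y" using y that by (simp add: periodic_points_def)
        ultimately show ?thesis using yX \<tau>X by simp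
      qed
      then show ?thesis using \<tau>X[OF yX] by (simp add: periodic_points_def)
    qed
    then have "\<tau> ` periodic_points d X k = periodic_points d X k"
      using finite_periodic_points[OF S(2) Xsub that] inj_on_subset[OF inj[unfolded top], of "periodic_points d X k"]
      by (intro endo_inj_surj) (auto simp: periodic_points_def)
    then show ?thesis by (auto simp: periodic_points_def)
  qed
  have "compactin ?T X"
    using compactin_full_shift[OF S(2) closed] by (simp add: compactin_subtopology)
  then have "compactin ?F (\<tau> ` X)"
    using image_compactin[OF _ cont] by (simp add: compactin_subtopology)
  moreover have "Hausdorff_space ?F"
    unfolding full_shift_topology_def by (simp add: Hausdorff_space_product_topology)
  ultimately have clo: "closedin ?F (\<tau> ` X)" by (simp add: compactin_imp_closedin)
  have "x \<in> \<tau> ` X" if x: "x \<in> X" for x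
  proof (rule ccontr)
    assume "x \<notin> \<tau> ` X"
    then have "x \<in> topspace ?F - \<tau> ` X" using x \<open>X \<subseteq> topspace ?F\<close> by blast
    moreover have "openin ?F (topspace ?F - \<tau> ` X)" using clo by blast
    ultimately obtain U where U: "finite {\<gamma> \<in> ?Z. U \<gamma> \<noteq> carrier S}" "x \<in> Pi\<^sub>E ?Z U"
      "Pi\<^sub>E ?Z U \<subseteq> topspace ?F - \<tau> ` X"
      unfolding full_shift_topology_def openin_product_topology_alt topspace_discrete_topology by meson
    obtain y k where y: "k > 0" "y \<in> periodic_points d X k" "\<forall>w\<in>{\<gamma> \<in> ?Z. U \<gamma> \<noteq> carrier S}. y w = x w"
      by (rule periodic_points_dense[OF assms x U(1) Collect_restrict])
    have "y \<in> (\<Pi>\<^sub>E \<gamma>\<in>?Z. carrier S)"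
      using y(2) Xsub by (auto simp: periodic_points_def full_shift_group_def)
    then have "y \<in> Pi\<^sub>E ?Z U"
      using y(3) U(2) by (auto simp: PiE_iff)
    then show False using U(3) per[OF y(1)] y(2) by blast
  qed
  then show "\<tau> ` topspace ?T = topspace ?T" using \<tau>X unfolding top by blast
qed

text \<open>Continuity is checked coordinatewise: each coordinate of a product, an inverse or a
  translate depends on a single coordinate of each argument. Metrizability holds because there
  are countably many coordinates.\<close>
lemma group_shift_dynamical_system:
  fixes S :: "('s, 'b) monoid_scheme"
  assumes S: "group S" "finite (carrier S)" and X: "subgroup X (full_shift_group d S)"
    and closed: "closedin (full_shift_topology d S) X"
    and invariant: "\<forall>\<gamma>\<in>carrier (lattice_group d). shift d \<gamma> ` X \<subseteq> X"
  shows "algebraic_dynamical_system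
      ((full_shift_group d S)\<lparr>carrier := X\<rparr>) (subtopology (full_shift_topology d S) X)
      (lattice_group d) (\<lambda>\<gamma>. restrict (shift d \<gamma>) X)"
proof -
  let ?P = "full_shift_group d S" and ?F = "full_shift_topology d S"
  let ?G = "?P\<lparr>carrier := X\<rparr>" and ?T = "subtopology ?F X" and ?L = "lattice_group d"
  let ?Z = "carrier ?L" and ?\<phi> = "\<lambda>\<gamma>. restrict (shift d \<gamma>) X"
  interpret S: group S by fact
  have P: "group ?P" unfolding full_shift_group_def by (rule product_group) (rule S(1))
  have L: "group ?L" unfolding lattice_group_def by (rule product_group) (rule group_integer_group)
  have G: "group ?G" by (rule subgroup.subgroup_is_group[OF X P])
  have top: "topspace ?T = X" using closedin_subset[OF closed] by auto
  have XS: "y \<in> (\<Pi>\<^sub>E \<gamma>\<in>?Z. carrier S)" if "y \<in> X" for y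
    using that subgroup.subset[OF X] by (auto simp: full_shift_group_def)
  have coord: "continuous_map ?T (discrete_topology (carrier S)) (\<lambda>y. y \<gamma>)" if "\<gamma> \<in> ?Z" for \<gamma>
    unfolding full_shift_topology_def
    by (rule continuous_map_from_subtopology[OF continuous_map_product_projection[OF that]])
  have into_T: "continuous_map A ?T f"
    if "f \<in> topspace A \<rightarrow> X" and "\<And>\<gamma>. \<gamma> \<in> ?Z \<Longrightarrow> continuous_map A (discrete_topology (carrier S)) (\<lambda>a. f a \<gamma>)"
    for A :: "'z topology" and f
    unfolding continuous_map_in_subtopology full_shift_topology_def continuous_map_componentwise
    using that XS by (fastforce simp: PiE_def)
  have inv_eq: "inv\<^bsub>?G\<^esub> y = (\<lambda>\<gamma>\<in>?Z. inv\<^bsub>S\<^esub> (y \<gamma>))" if "y \<in> X" for y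
  proof -
    have "inv\<^bsub>?G\<^esub> y = inv\<^bsub>?P\<^esub> y" by (rule group.m_inv_consistent[OF P X that])
    also have "\<dots> = (\<lambda>\<gamma>\<in>?Z. inv\<^bsub>S\<^esub> (y \<gamma>))"
      unfolding full_shift_group_def using XS[OF that] S(1) by (rule inv_product_group)
    finally show ?thesis .
  qed
  have TG: "topological_group ?G ?T"
  proof (intro topological_group.intro topological_group_axioms.intro G)
    show "topspace ?T = carrier ?G" using top by simp
    show "continuous_map (prod_topology ?T ?T) ?T (\<lambda>(x, y). x \<otimes>\<^bsub>?G\<^esub> y)"
    proof (rule into_T)
      show "(\<lambda>(x, y). x \<otimes>\<^bsub>?G\<^esub> y) \<in> topspace (prod_topology ?T ?T) \<rightarrow> X"
        using subgroup.m_closed[OF X] by (auto simp: top)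
      fix \<gamma> assume \<gamma>: "\<gamma> \<in> ?Z"
      let ?D = "discrete_topology (carrier S)"
      have "continuous_map (prod_topology ?T ?T) (prod_topology ?D ?D) (\<lambda>p. (fst p \<gamma>, snd p \<gamma>))"
        using continuous_map_compose[OF continuous_map_fst coord[OF \<gamma>], of ?T]
          continuous_map_compose[OF continuous_map_snd coord[OF \<gamma>], of ?T]
        by (intro continuous_map_pairedI) (simp_all add: comp_def)
      moreover have "continuous_map (prod_topology ?D ?D) ?D (\<lambda>(s, t). s \<otimes>\<^bsub>S\<^esub> t)"
        by (auto simp: prod_topology_discrete_topology[symmetric])
      ultimately have "continuous_map (prod_topology ?T ?T) ?D ((\<lambda>(s, t). s \<otimes>\<^bsub>S\<^esub> t) \<circ> (\<lambda>p. (fst p \<gamma>, snd p \<gamma>)))"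
        by (rule continuous_map_compose)
      moreover have "(\<lambda>p. (case p of (x, y) \<Rightarrow> x \<otimes>\<^bsub>?G\<^esub> y) \<gamma>) = (\<lambda>(s, t). s \<otimes>\<^bsub>S\<^esub> t) \<circ> (\<lambda>p. (fst p \<gamma>, snd p \<gamma>))"
        using \<gamma> by (auto simp: fun_eq_iff full_shift_group_def)
      ultimately show "continuous_map (prod_topology ?T ?T) ?D (\<lambda>p. (case p of (x, y) \<Rightarrow> x \<otimes>\<^bsub>?G\<^esub> y) \<gamma>)"
        by simp
    qed
    show "continuous_map ?T ?T (\<lambda>x. inv\<^bsub>?G\<^esub> x)"
    proof (rule into_T)
      show "(\<lambda>x. inv\<^bsub>?G\<^esub> x) \<in> topspace ?T \<rightarrow> X"
        using group.inv_closed[OF G] by (auto simp: top)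
      fix \<gamma> assume \<gamma>: "\<gamma> \<in> ?Z"
      have "continuous_map ?T (discrete_topology (carrier S)) ((\<lambda>s. inv\<^bsub>S\<^esub> s) \<circ> (\<lambda>y. y \<gamma>))"
        by (rule continuous_map_compose[OF coord[OF \<gamma>]]) auto
      then show "continuous_map ?T (discrete_topology (carrier S)) (\<lambda>y. (inv\<^bsub>?G\<^esub> y) \<gamma>)"
        by (rule continuous_map_eq) (use inv_eq \<gamma> top in auto)
    qed
  qed
  have shift_X: "shift d \<gamma> y \<in> X" if "\<gamma> \<in> ?Z" "y \<in> X" for \<gamma> y
    using invariant that by blast
  have comp: "?\<phi> \<gamma> (?\<phi> \<delta> y) = ?\<phi> (\<gamma> \<otimes>\<^bsub>?L\<^esub> \<delta>) y" if "\<gamma> \<in> ?Z" "\<delta> \<in> ?Z" "y \<in> X" for \<gamma> \<delta> y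
    using shift_shift shift_X[OF that(2,3)] that(3) by simp
  have one: "?\<phi> \<one>\<^bsub>?L\<^esub> y = y" if "y \<in> X" for y
    using shift_one XS[OF that] that by (auto simp: PiE_def)
  have bij: "?\<phi> \<gamma> \<in> Bij X" if \<gamma>: "\<gamma> \<in> ?Z" for \<gamma>
  proof -
    have i: "inv\<^bsub>?L\<^esub> \<gamma> \<in> ?Z" by (rule group.inv_closed[OF L \<gamma>])
    have "bij_betw (?\<phi> \<gamma>) X X"
    proof (rule bij_betw_byWitness[where f' = "?\<phi> (inv\<^bsub>?L\<^esub> \<gamma>)"])
      show "\<forall>y\<in>X. ?\<phi> (inv\<^bsub>?L\<^esub> \<gamma>) (?\<phi> \<gamma> y) = y" "\<forall>y\<in>X. ?\<phi> \<gamma> (?\<phi> (inv\<^bsub>?L\<^esub> \<gamma>) y) = y"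
        using comp \<gamma> i one group.l_inv[OF L \<gamma>] group.r_inv[OF L \<gamma>] by metis+
    qed (use shift_X \<gamma> i in auto)
    then show ?thesis by (simp add: Bij_def)
  qed
  have act: "group_action ?L X ?\<phi>"
    unfolding group_action_def group_hom_def group_hom_axioms_def
  proof (intro conjI L group_BijGroup)
    show "?\<phi> \<in> hom ?L (BijGroup X)"
    proof (rule homI)
      fix \<gamma> \<delta> assume \<gamma>: "\<gamma> \<in> ?Z" and \<delta>: "\<delta> \<in> ?Z"
      have "?\<phi> (\<gamma> \<otimes>\<^bsub>?L\<^esub> \<delta>) = compose X (?\<phi> \<gamma>) (?\<phi> \<delta>)"
      proof
        show "?\<phi> (\<gamma> \<otimes>\<^bsub>?L\<^esub> \<delta>) y = compose X (?\<phi> \<gamma>) (?\<phi> \<delta>) y" for y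
          using comp[OF \<gamma> \<delta>, of y] by (cases "y \<in> X") (simp_all add: compose_def shift_X[OF \<delta>])
      qed
      then show "?\<phi> (\<gamma> \<otimes>\<^bsub>?L\<^esub> \<delta>) = ?\<phi> \<gamma> \<otimes>\<^bsub>BijGroup X\<^esub> ?\<phi> \<delta>"
        using bij[OF \<gamma>] bij[OF \<delta>] by (simp add: BijGroup_def)
    qed (use bij in \<open>simp add: BijGroup_def\<close>)
  qed
  show ?thesis
  proof (intro algebraic_dynamical_system.intro algebraic_dynamical_system_axioms.intro TG)
    show "group_action ?L (carrier ?G) ?\<phi>" using act by simp
    show "compact_space ?T"
      using compactin_full_shift[OF S(2) closed] by (rule compact_space_subtopology)
    have "countable ?Z" unfolding carrier_lattice_group by (rule countable_PiE) auto
    then show "countable (carrier ?L)" .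
    have "metrizable_space ?F"
      unfolding full_shift_topology_def metrizable_space_product_topology
      using \<open>countable ?Z\<close> by (auto simp: metrizable_space_discrete_topology intro: countable_subset[of _ ?Z])
    then show "metrizable_space ?T" by (rule metrizable_space_subtopology)
    fix \<gamma> assume \<gamma>: "\<gamma> \<in> ?Z"
    have "?\<phi> \<gamma> (y \<otimes>\<^bsub>?P\<^esub> z) = ?\<phi> \<gamma> y \<otimes>\<^bsub>?P\<^esub> ?\<phi> \<gamma> z" if "y \<in> X" "z \<in> X" for y z
    proof -
      have "shift d \<gamma> (y \<otimes>\<^bsub>?P\<^esub> z) = shift d \<gamma> y \<otimes>\<^bsub>?P\<^esub> shift d \<gamma> z"
        by (auto simp: fun_eq_iff shift_def full_shift_group_def restrict_in_lattice_group)
      then show ?thesis using that subgroup.m_closed[OF X that] by simp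
    qed
    then show "?\<phi> \<gamma> \<in> auto ?G"
      using bij[OF \<gamma>] shift_X[OF \<gamma>] unfolding auto_def hom_def by auto
    show "continuous_map ?T ?T (?\<phi> \<gamma>)"
    proof (rule into_T)
      show "?\<phi> \<gamma> \<in> topspace ?T \<rightarrow> X" using shift_X[OF \<gamma>] by (auto simp: top)
      fix \<delta> assume \<delta>: "\<delta> \<in> ?Z"
      have "continuous_map ?T (discrete_topology (carrier S)) (\<lambda>y. y (\<lambda>i\<in>{..<d}. \<delta> i - \<gamma> i))"
        by (rule coord) (rule restrict_in_lattice_group)
      then show "continuous_map ?T (discrete_topology (carrier S)) (\<lambda>y. ?\<phi> \<gamma> y \<delta>)"
        by (rule continuous_map_eq) (use \<delta> top in \<open>auto simp: shift_def\<close>)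
    qed
  qed
qed

theorem corollary1p4:
  fixes d :: nat and S :: "('s, 'b) monoid_scheme" and X :: "((nat \<Rightarrow> int) \<Rightarrow> 's) set"
  assumes "d \<ge> 1"
    and "group S" and "finite (carrier S)"
    and "subgroup X (full_shift_group d S)"
    and "closedin (full_shift_topology d S) X"
    and "\<forall>\<gamma>\<in>carrier (lattice_group d). shift d \<gamma> ` X \<subseteq> X"
  shows "algebraic_dynamical_system
      ((full_shift_group d S)\<lparr>carrier := X\<rparr>) (subtopology (full_shift_topology d S) X)
      (lattice_group d) (\<lambda>\<gamma>. restrict (shift d \<gamma>) X)
    \<and> surjunctive (subtopology (full_shift_topology d S) X)
      (lattice_group d) (\<lambda>\<gamma>. restrict (shift d \<gamma>) X)"
  using group_shift_dynamical_system[OF assms(2-6)] group_shift_surjunctive[OF assms(2-6)] ..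

end
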